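(* Let $p\in[1,\infty]$ and let $E=\{E_a\}_{a=1}^{n_E}$ and $F=\{F_b\}_{b=1}^{n_F}$ be measurements acting on $\mathbb{C}^d$ which are maximally incompatible with respect to $\Upsilon_p$, i.e. $\Upsilon_p(E,F)=2^{\frac1p}\,d\sqrt{d-1}$. Then $$\eta^{g}(E,F)=\frac12\Big(1+\frac{1}{\sqrt d}\Big),$$ i.e. the pair $(E,F)$ achieves the lowest possible value of the incompatibility generalized robustness $\eta^g$ among pairs of measurements acting on $\mathbb{C}^d$.
   Context: A measurement with $n$ outcomes acting on $\mathbb{C}^d$ is a family $\{E_a\}_{a=1}^n$ of non-zero positive semi-definite operators on $\mathbb{C}^d$ with $\sum_a E_a=\mathbb{1}$. The Schatten $p$-norm $\|A\|_p$ is the $\ell_p$-norm of the vector of singular values of $A$ (the largest singular value for $p=\infty$). Define $\Upsilon_p(E,F):=\sum_{a,b}\|[E_a,F_b]\|_p$, where $[A,B]=AB-BA$. Convention: $2^{1/p}=1$ for $p=\infty$. The value $2^{1/p}d\sqrt{d-1}$ is the largest value of $\Upsilon_p$ over all pairs of measurements on $\mathbb{C}^d$. The incompatibility generalized robustness $\eta^g(E,F)$ is the maximum of $\eta\in\mathbb{R}$ over all $\eta$ and all families $\{G_{ab}\}$ of operators on $\mathbb{C}^d$ ($a\in\{1,\dots,n_E\}$, $b\in\{1,\dots,n_F\}$) satisfying $G_{ab}\ge 0$ for all $a,b$, $\sum_b G_{ab}\ge\eta E_a$ for all $a$, $\sum_a G_{ab}\ge\eta F_b$ for all $b$, and $\sum_{ab}G_{ab}=\mathbb{1}$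 (inequalities in the positive semi-definite order). It is known from earlier work that $\eta^g(E',F')\ge\frac12\big(1+\frac1{\sqrt d}\big)$ for every pair of measurements $E',F'$ acting on $\mathbb{C}^d$. *)

theory Defs
  imports
    "Jordan_Normal_Form.Schur_Decomposition"
    "HOL-Library.Extended_Real"
begin

(* Operators on C^d are complex matrices in carrier_mat d d. *)

definition mat_sum :: "nat \<Rightarrow> ('i \<Rightarrow> complex mat) \<Rightarrow> 'i set \<Rightarrow> complex mat" where
  "mat_sum d A I = mat d d (\<lambda>(i, j). \<Sum>k\<in>I. A k $$ (i, j))"

(* The order on complex is that of HOL-Library.Complex_Order: 0 \<le> z states that z is real
   and nonnegative, so Hermiticity is implied. *)
definition psd :: "nat \<Rightarrow> complex mat \<Rightarrow> bool" where
  "psd d A \<longleftrightarrow> A \<in> carrier_mat d d \<and> (\<forall>v \<in> carrier_vec d. 0 \<le> (A *\<^sub>v v) \<bullet>c v)"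

definition loewner_le :: "nat \<Rightarrow> complex mat \<Rightarrow> complex mat \<Rightarrow> bool" where
  "loewner_le d A B \<longleftrightarrow> A \<in> carrier_mat d d \<and> B \<in> carrier_mat d d \<and> psd d (B - A)"

(* The outcomes are 1, ..., n; values of E outside {1..n} are irrelevant. *)
definition measurement :: "nat \<Rightarrow> nat \<Rightarrow> (nat \<Rightarrow> complex mat) \<Rightarrow> bool" where
  "measurement d n E \<longleftrightarrow>
     (\<forall>a\<in>{1..n}. psd d (E a) \<and> E a \<noteq> 0\<^sub>m d d) \<and> mat_sum d E {1..n} = 1\<^sub>m d"

definition commutator :: "complex mat \<Rightarrow> complex mat \<Rightarrow> complex mat" where
  "commutator A B = A * B - B * A"

(* Square roots of the eigenvalues of A^* A (which are real and nonnegative), with multiplicity. *)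
definition singular_values :: "complex mat \<Rightarrow> real multiset" where
  "singular_values A = image_mset (\<lambda>z. sqrt (Re z)) (proots (char_poly (mat_adjoint A * A)))"

definition schatten_norm :: "ereal \<Rightarrow> complex mat \<Rightarrow> real" where
  "schatten_norm p A =
     (if p = \<infinity> then Max (set_mset (singular_values A))
      else (\<Sum>s\<in>#singular_values A. s powr real_of_ereal p) powr (1 / real_of_ereal p))"

definition Upsilon ::
  "ereal \<Rightarrow> nat \<Rightarrow> (nat \<Rightarrow> complex mat) \<Rightarrow> nat \<Rightarrow> (nat \<Rightarrow> complex mat) \<Rightarrow> real" where
  "Upsilon p nE E nF F = (\<Sum>a\<in>{1..nE}. \<Sum>b\<in>{1..nF}. schatten_norm p (commutator (E a) (F b)))"

definition two_root :: "ereal \<Rightarrow> real" where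
  "two_root p = (if p = \<infinity> then 1 else 2 powr (1 / real_of_ereal p))"

definition robustness_feasible ::
  "nat \<Rightarrow> nat \<Rightarrow> (nat \<Rightarrow> complex mat) \<Rightarrow> nat \<Rightarrow> (nat \<Rightarrow> complex mat)
    \<Rightarrow> real \<Rightarrow> (nat \<Rightarrow> nat \<Rightarrow> complex mat) \<Rightarrow> bool" where
  "robustness_feasible d nE E nF F \<eta> G \<longleftrightarrow>
     (\<forall>a\<in>{1..nE}. \<forall>b\<in>{1..nF}. psd d (G a b)) \<and>
     (\<forall>a\<in>{1..nE}. loewner_le d (complex_of_real \<eta> \<cdot>\<^sub>m E a) (mat_sum d (\<lambda>b. G a b) {1..nF})) \<and>
     (\<forall>b\<in>{1..nF}. loewner_le d (complex_of_real \<eta> \<cdot>\<^sub>m F b) (mat_sum d (\<lambda>a. G a b) {1..nE})) \<and>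
     mat_sum d (\<lambda>(a, b). G a b) ({1..nE} \<times> {1..nF}) = 1\<^sub>m d"

definition generalized_robustness ::
  "nat \<Rightarrow> nat \<Rightarrow> (nat \<Rightarrow> complex mat) \<Rightarrow> nat \<Rightarrow> (nat \<Rightarrow> complex mat) \<Rightarrow> real" where
  "generalized_robustness d nE E nF F = (GREATEST \<eta>. \<exists>G. robustness_feasible d nE E nF F \<eta> G)"

end

theory Submission
  imports Defs
begin

text \<open>If the measurements are refined into rank-one operators w_k w_k^* and u_m u_m^*, then the numbers
  |<w_k, u_m>|^2 have sum d, while |w_k|^2 |u_m|^2 have sum d^2. The commutator of two operators is
  skew-Hermitian with trace zero, so its Schatten p-norm is at most 2^(1/p) times half its trace norm,
  and half the trace norm is at most the sum over the refinements of
  |<w, u>| sqrt (|w|^2 |u|^2 - |<w, u>|^2). Concavity of sqrt (x (1 - x)) gives the bound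
  2^(1/p) d sqrt (d - 1), with equality only if d |<w, u>|^2 = |w|^2 |u|^2 for all parts of all
  refinements. As every vector of the range of an effect is a part of some refinement, a maximal
  pair consists of rank-one effects with all overlaps equal to 1 / d: a vector of the range of
  an effect of E that is orthogonal to some u vanishes. Pairing a feasible family with the sum of the two
  normalised effects, whose norm is 1 + 1 / sqrt d, bounds the robustness from above.

  The lower bound, for arbitrary measurements, comes from an explicit family: if E_a is the sum of
  \<alpha>_k P_k with rank-one projections P_k, take G_ab proportional to the sum of
  \<alpha>_k (P_k + 1 / sqrt d) F_b (P_k + 1 / sqrt d).\<close>

section \<open>Sesquilinear forms and Cholesky decomposition\<close>

text \<open>Two obstacles shape the proof. A fixed decomposition of the effects, such as the
  spectral one, would give the equality of overlaps only for its own vectors, which does not prevent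
  an effect from having rank two. Hence the decompositions must be able to contain an arbitrary
  prescribed vector of the range. Cholesky elimination with a free pivot provides this, and inside a
  range of dimension two a nonzero vector orthogonal to a given one could then be prescribed. The
  other obstacle is that \<open>GREATEST\<close> carries information only if a greatest element
  exists. For a maximal pair the upper bound and the explicit family meet, so the maximum is
  exhibited. For the pairs that it is compared with, no optimal family is at hand, and existence
  comes from compactness: feasible families have bounded entries, and all constraints survive
  limits.\<close>

text \<open>Vectors and matrices are functions of their indices, of which only the values at indices below d
  matter; the entries of elements of carrier_mat d d are read off as such functions.\<close>

definition ip :: "nat \<Rightarrow> (nat \<Rightarrow> complex) \<Rightarrow> (nat \<Rightarrow> complex) \<Rightarrow> complex" where
  "ip d x y = (\<Sum>i<d. x i * cnj (y i))"

definition sqn :: "nat \<Rightarrow> (nat \<Rightarrow> complex) \<Rightarrow> real" where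
  "sqn d x = (\<Sum>i<d. (cmod (x i))\<^sup>2)"

definition mv :: "nat \<Rightarrow> (nat \<Rightarrow> nat \<Rightarrow> complex) \<Rightarrow> (nat \<Rightarrow> complex) \<Rightarrow> nat \<Rightarrow> complex" where
  "mv d A x = (\<lambda>i. \<Sum>j<d. A i j * x j)"

definition sform :: "nat \<Rightarrow> (nat \<Rightarrow> nat \<Rightarrow> complex) \<Rightarrow> (nat \<Rightarrow> complex) \<Rightarrow> (nat \<Rightarrow> complex) \<Rightarrow> complex" where
  "sform d A x y = ip d (mv d A x) y"

definition pos :: "nat \<Rightarrow> (nat \<Rightarrow> nat \<Rightarrow> complex) \<Rightarrow> bool" where
  "pos d A \<longleftrightarrow> (\<forall>x. 0 \<le> sform d A x x)"

definition delta :: "nat \<Rightarrow> nat \<Rightarrow> complex" where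
  "delta j = (\<lambda>i. if i = j then 1 else 0)"

lemma ip_cong: "(\<And>i. i < d \<Longrightarrow> x i = x' i) \<Longrightarrow> (\<And>i. i < d \<Longrightarrow> y i = y' i) \<Longrightarrow> ip d x y = ip d x' y'"
  by (simp add: ip_def)

lemma ip_add_left: "ip d (\<lambda>i. x i + y i) z = ip d x z + ip d y z"
  by (simp add: ip_def distrib_right sum.distrib)

lemma ip_add_right: "ip d z (\<lambda>i. x i + y i) = ip d z x + ip d z y"
  by (simp add: ip_def distrib_left sum.distrib)

lemma ip_diff_left: "ip d (\<lambda>i. x i - y i) z = ip d x z - ip d y z"
  by (simp add: ip_def left_diff_distrib sum_subtractf)

lemma ip_diff_right: "ip d z (\<lambda>i. x i - y i) = ip d z x - ip d z y"
  by (simp add: ip_def right_diff_distrib sum_subtractf)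

lemma ip_scale_left: "ip d (\<lambda>i. c * x i) z = c * ip d x z"
  by (simp add: ip_def sum_distrib_left mult.assoc)

lemma ip_scale_right: "ip d z (\<lambda>i. c * x i) = cnj c * ip d z x"
  by (simp add: ip_def sum_distrib_left algebra_simps)

lemma ip_sum_left: "ip d (\<lambda>i. \<Sum>k\<in>K. f k i) z = (\<Sum>k\<in>K. ip d (f k) z)"
  unfolding ip_def sum_distrib_right by (rule sum.swap)

lemma ip_sum_right: "ip d z (\<lambda>i. \<Sum>k\<in>K. f k i) = (\<Sum>k\<in>K. ip d z (f k))"
  unfolding ip_def cnj_sum sum_distrib_left by (rule sum.swap)

lemma ip_commute: "ip d y x = cnj (ip d x y)"
  by (simp add: ip_def mult.commute)

lemma ip_self: "ip d x x = of_real (sqn d x)"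
  by (simp add: ip_def sqn_def complex_norm_square del: of_real_power)

lemma sqn_nonneg: "0 \<le> sqn d x"
  by (simp add: sqn_def sum_nonneg)

lemma sqn_eq_0_iff: "sqn d x = 0 \<longleftrightarrow> (\<forall>i<d. x i = 0)"
  by (auto simp: sqn_def sum_nonneg_eq_0_iff)

lemma sqn_scale: "sqn d (\<lambda>i. c * x i) = (cmod c)\<^sup>2 * sqn d x"
  by (simp add: sqn_def norm_mult power_mult_distrib sum_distrib_left)

lemma cmod_ip_commute: "cmod (ip d y x) = cmod (ip d x y)"
  by (metis ip_commute complex_mod_cnj)

lemma mult_cnj_of_real: "z * cnj z = of_real ((cmod z)\<^sup>2)"
  by (simp add: complex_norm_square del: of_real_power)

lemma mv_add: "mv d A (\<lambda>i. x i + y i) = (\<lambda>i. mv d A x i + mv d A y i)"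
  by (simp add: mv_def distrib_left sum.distrib)

lemma mv_scale: "mv d A (\<lambda>i. c * x i) = (\<lambda>i. c * mv d A x i)"
  by (simp add: mv_def sum_distrib_left algebra_simps)

lemma mv_sum: "mv d A (\<lambda>i. \<Sum>k\<in>K. f k i) = (\<lambda>i. \<Sum>k\<in>K. mv d A (f k) i)"
  unfolding mv_def sum_distrib_left by (rule ext, rule sum.swap)

lemma mv_delta: "j < d \<Longrightarrow> mv d A (delta j) = (\<lambda>i. A i j)"
  by (simp add: mv_def delta_def if_distrib cong: if_cong)

lemma ip_delta: "j < d \<Longrightarrow> ip d x (delta j) = x j"
  by (simp add: ip_def delta_def if_distrib cong: if_cong)

lemma sform_add_left: "sform d A (\<lambda>i. x i + y i) z = sform d A x z + sform d A y z"
  by (simp add: sform_def mv_add ip_add_left)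

lemma sform_add_right: "sform d A z (\<lambda>i. x i + y i) = sform d A z x + sform d A z y"
  by (simp add: sform_def ip_add_right)

lemma sform_scale_left: "sform d A (\<lambda>i. c * x i) z = c * sform d A x z"
  by (simp add: sform_def mv_scale ip_scale_left)

lemma sform_scale_right: "sform d A z (\<lambda>i. c * x i) = cnj c * sform d A z x"
  by (simp add: sform_def ip_scale_right)

lemma sform_sum_left: "sform d A (\<lambda>i. \<Sum>k\<in>K. f k i) z = (\<Sum>k\<in>K. sform d A (f k) z)"
  by (simp add: sform_def mv_sum ip_sum_left)

lemma sform_sum_right: "sform d A z (\<lambda>i. \<Sum>k\<in>K. f k i) = (\<Sum>k\<in>K. sform d A z (f k))"
  by (simp add: sform_def ip_sum_right)

lemma sform_delta: "i < d \<Longrightarrow> j < d \<Longrightarrow> sform d A (delta j) (delta i) = A i j"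
  by (simp add: sform_def mv_delta ip_delta)

lemma sform_cong:
  assumes "\<And>i j. i < d \<Longrightarrow> j < d \<Longrightarrow> A i j = B i j"
    and "\<And>i. i < d \<Longrightarrow> x i = x' i" and "\<And>i. i < d \<Longrightarrow> y i = y' i"
  shows "sform d A x y = sform d B x' y'"
  unfolding sform_def mv_def by (rule ip_cong) (use assms in auto)

lemma sform_entries: "sform d A x y = (\<Sum>i<d. \<Sum>j<d. A i j * x j * cnj (y i))"
  by (simp add: sform_def mv_def ip_def sum_distrib_right)

lemma sform_sum_kernel:
  "sform d (\<lambda>i j. \<Sum>k\<in>K. A k i j) x y = (\<Sum>k\<in>K. sform d (A k) x y)"
proof -
  have "mv d (\<lambda>i j. \<Sum>k\<in>K. A k i j) x = (\<lambda>i. \<Sum>k\<in>K. mv d (A k) x i)"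
    unfolding mv_def sum_distrib_right by (rule ext, rule sum.swap)
  then show ?thesis by (simp add: sform_def ip_sum_left)
qed

lemma sform_diff_kernel:
  "sform d (\<lambda>i j. A i j - B i j) x y = sform d A x y - sform d B x y"
  by (simp add: sform_entries left_diff_distrib sum_subtractf)

lemma sform_scale_kernel: "sform d (\<lambda>i j. c * A i j) x y = c * sform d A x y"
  by (simp add: sform_entries sum_distrib_left mult.assoc)

lemma sform_rank_one: "sform d (\<lambda>i j. w i * cnj (u j)) x y = ip d x u * ip d w y"
  unfolding sform_entries ip_def sum_product by (subst sum.swap) (simp add: algebra_simps)

lemma sform_id: "sform d (\<lambda>i j. if i = j then 1 else 0) x y = ip d x y"
proof -
  have "mv d (\<lambda>i j. if i = j then 1 else 0) x i = x i" if "i < d" for i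
    using that by (simp add: mv_def if_distrib[of "\<lambda>c. c * _"] cong: if_cong)
  then show ?thesis unfolding sform_def by (intro ip_cong) auto
qed

lemma sform_combination:
  "sform d A (\<lambda>i. x i + t * y i) (\<lambda>i. x i + t * y i) =
    sform d A x x + cnj t * sform d A x y + t * sform d A y x + of_real ((cmod t)\<^sup>2) * sform d A y y"
  unfolding sform_add_left sform_add_right sform_scale_left sform_scale_right
  by (simp add: complex_norm_square algebra_simps del: of_real_power)

text \<open>Polarisation with the coefficients 1 and \<open>\<i>\<close>: over the complex numbers a
  form that vanishes on the diagonal is zero, Hermitian or not.\<close>

lemma kernel_eqI:
  assumes "\<And>x. sform d A x x = sform d B x x" and "i < d" and "j < d"
  shows "A i j = B i j"
proof -
  let ?D = "\<lambda>i j. A i j - B i j"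
  let ?x = "delta j" and ?y = "delta i"
  have D0: "sform d ?D x x = 0" for x by (simp add: sform_diff_kernel assms(1))
  have "sform d ?D ?x ?y + sform d ?D ?y ?x = 0"
    using sform_combination[of d ?D ?x 1 ?y] unfolding D0 by simp
  moreover have "sform d ?D ?y ?x = sform d ?D ?x ?y"
    using sform_combination[of d ?D ?x \<i> ?y] unfolding D0 by simp
  ultimately have "sform d ?D ?x ?y = 0" by simp
  then show ?thesis using assms by (simp add: sform_delta)
qed

section \<open>Positive semidefinite forms\<close>

lemma posD: "pos d A \<Longrightarrow> 0 \<le> Re (sform d A x x)" "pos d A \<Longrightarrow> Im (sform d A x x) = 0"
  by (simp_all add: pos_def less_eq_complex_def)

lemma pos_sform_self: "pos d A \<Longrightarrow> sform d A x x = of_real (Re (sform d A x x))"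
  by (simp add: complex_eq_iff posD)

text \<open>The form is real at \<open>x + y\<close> and at \<open>x + \<i> y\<close>; these two
  conditions relate the imaginary and the real parts of the two mixed terms.\<close>

lemma pos_commute:
  assumes "pos d A"
  shows "sform d A y x = cnj (sform d A x y)"
proof -
  note im = posD(2)[OF assms]
  have "Im (sform d A x y) + Im (sform d A y x) = 0"
    using im[of "\<lambda>i. x i + 1 * y i"] unfolding sform_combination by (simp add: im)
  moreover have "Re (sform d A y x) = Re (sform d A x y)"
    using im[of "\<lambda>i. x i + \<i> * y i"] unfolding sform_combination by (simp add: im)
  ultimately show ?thesis by (simp add: complex_eq_iff)
qed

lemma pos_cauchy_schwarz:
  assumes "pos d A"
  shows "(cmod (sform d A x y))\<^sup>2 \<le> Re (sform d A x x) * Re (sform d A y y)"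
proof -
  define a b m where "a = Re (sform d A x x)" and "b = Re (sform d A y y)"
    and "m = (cmod (sform d A x y))\<^sup>2"
  have a: "0 \<le> a" and b: "0 \<le> b" and m: "0 \<le> m" by (simp_all add: a_def b_def m_def posD assms)
  have key: "0 \<le> a - 2 * s * m + s\<^sup>2 * m * b" for s :: real
  proof -
    \<comment> \<open>This phase makes both mixed terms real and equal, which leaves a quadratic
      polynomial in the real variable \<open>s\<close>.\<close>
    let ?t = "- of_real s * sform d A x y"
    have 1: "Re (cnj ?t * sform d A x y) = - s * m" "Re (?t * sform d A y x) = - s * m"
      unfolding m_def pos_commute[OF assms, of y x] cmod_power2
      by (simp_all add: power2_eq_square algebra_simps)
    have 2: "(cmod ?t)\<^sup>2 = s\<^sup>2 * m"
      unfolding m_def by (simp add: norm_mult power_mult_distrib)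
    have "0 \<le> Re (sform d A (\<lambda>i. x i + ?t * y i) (\<lambda>i. x i + ?t * y i))"
      using assms by (rule posD)
    also have "\<dots> = a - 2 * s * m + s\<^sup>2 * m * b"
      unfolding sform_combination plus_complex.simps 1 2 by (simp add: a_def b_def)
    finally show ?thesis .
  qed
  have "m \<le> a * b"
  proof (cases "b = 0")
    case True
    have "m = 0"
    proof (rule ccontr)
      assume "m \<noteq> 0"
      \<comment> \<open>For \<open>b = 0\<close> the polynomial is affine in \<open>s\<close>, and
        at this point its value is -1.\<close>
      then show False using key[of "(a + 1) / (2 * m)"] True by (simp add: field_simps)
    qed
    then show ?thesis using True by simp
  next
    case False
    then show ?thesis using key[of "1 / b"] b by (simp add: field_simps power2_eq_square)
  qed
  then show ?thesis by (simp add: a_def b_def m_def)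
qed

lemma pos_id: "pos d (\<lambda>i j. if i = j then 1 else 0)"
  by (simp add: pos_def sform_id ip_self less_eq_complex_def sqn_nonneg)

lemma cauchy_schwarz: "(cmod (ip d x y))\<^sup>2 \<le> sqn d x * sqn d y"
  using pos_cauchy_schwarz[OF pos_id, of d x y] by (simp add: sform_id ip_self)

text \<open>Positivity of the remainder is exactly the Cauchy-Schwarz inequality for the form of
  \<open>A\<close>. This is one elimination step with an arbitrary pivot vector \<open>x\<close>
  instead of a basis vector.\<close>

lemma pos_minus_rank_one:
  assumes "pos d A" and "0 < Re (sform d A x x)"
    and w: "w = (\<lambda>i. mv d A x i / of_real (sqrt (Re (sform d A x x))))"
  shows "pos d (\<lambda>i j. A i j - w i * cnj (w j))"
  unfolding pos_def
proof
  fix y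
  let ?c = "Re (sform d A x x)"
  have wy: "ip d w y = sform d A x y / of_real (sqrt ?c)"
    using ip_scale_left[of d "inverse (of_real (sqrt ?c))" "mv d A x" y]
    by (simp add: w sform_def field_simps)
  have "(cmod (ip d w y))\<^sup>2 = (cmod (sform d A x y))\<^sup>2 / ?c"
    unfolding wy using assms(2) by (simp add: norm_divide power_divide)
  also have "\<dots> \<le> Re (sform d A y y)"
    using pos_cauchy_schwarz[OF assms(1), of x y] assms(2) by (simp add: field_simps)
  finally have le: "(cmod (ip d w y))\<^sup>2 \<le> Re (sform d A y y)" .
  have "sform d (\<lambda>i j. A i j - w i * cnj (w j)) y y
      = of_real (Re (sform d A y y) - (cmod (ip d w y))\<^sup>2)"
    unfolding sform_diff_kernel sform_rank_one ip_commute[of d y w]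
      pos_sform_self[OF assms(1), of y, symmetric]
    by (simp add: complex_norm_square mult.commute pos_sform_self[OF assms(1), of y, symmetric] del: of_real_power)
  then show "0 \<le> sform d (\<lambda>i j. A i j - w i * cnj (w j)) y y"
    using le by (simp add: less_eq_complex_def)
qed

text \<open>Elimination from the last index downwards: \<open>n\<close> bounds the indices whose
  diagonal entry may be nonzero, and a zero diagonal entry kills its row and column by
  Cauchy-Schwarz. A zero pivot contributes the zero vector, so semidefiniteness suffices.\<close>

lemma pos_cholesky_aux:
  assumes "pos d A" and "n \<le> d" and "\<And>i. n \<le> i \<Longrightarrow> i < d \<Longrightarrow> A i i = 0"
  shows "\<exists>w. \<forall>i<d. \<forall>j<d. A i j = (\<Sum>k<n. w k i * cnj (w k j))"
  using assms
proof (induction n arbitrary: A)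
  case 0
  have "A i j = 0" if "i < d" "j < d" for i j
    using pos_cauchy_schwarz[OF 0(1), of "delta j" "delta i"] 0(3)[of i] that
    by (simp add: sform_delta)
  then show ?case by simp
next
  case (Suc n)
  show ?case
  proof (cases "A n n = 0")
    case True
    have "\<And>i. n \<le> i \<Longrightarrow> i < d \<Longrightarrow> A i i = 0"
      using Suc.prems(3) True by (metis Suc_leI le_neq_implies_less)
    then obtain w where "\<forall>i<d. \<forall>j<d. A i j = (\<Sum>k<n. w k i * cnj (w k j))"
      using Suc.IH[of A] Suc.prems by auto
    then show ?thesis by (intro exI[of _ "w(n := \<lambda>_. 0)"]) simp
  next
    case False
    have n: "n < d" using Suc.prems(2) by simp
    have diag: "sform d A (delta i) (delta i) = A i i" if "i < d" for i
      using that by (simp add: sform_delta)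
    have "A n n = of_real (Re (A n n))"
      using pos_sform_self[OF Suc.prems(1), of "delta n"] unfolding diag[OF n] .
    moreover have "0 \<le> Re (A n n)"
      using posD(1)[OF Suc.prems(1), of "delta n"] unfolding diag[OF n] .
    ultimately have An: "0 < Re (A n n)" "A n n = of_real (Re (A n n))"
      using False by (auto simp: complex_eq_iff)
    define u where "u = (\<lambda>i. mv d A (delta n) i / of_real (sqrt (Re (sform d A (delta n) (delta n)))))"
    have u: "u i = A i n / of_real (sqrt (Re (A n n)))" for i
      using n by (simp add: u_def mv_delta sform_delta)
    define A' where "A' = (\<lambda>i j. A i j - u i * cnj (u j))"
    have pos': "pos d A'"
      unfolding A'_def by (rule pos_minus_rank_one[OF Suc.prems(1) _ u_def]) (simp add: sform_delta n An(1))
    have uu: "u i * cnj (u i) = of_real ((cmod (A i n))\<^sup>2 / Re (A n n))" for i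
      unfolding mult_cnj_of_real u using An(1) by (simp add: norm_divide power_divide)
    have "A' i i = 0" if i: "n \<le> i" "i < d" for i
    proof (cases "i = n")
      case True
      have "u n * cnj (u n) = of_real (Re (A n n))"
        unfolding uu by (subst An(2)) (use An(1) in \<open>simp add: power2_eq_square\<close>)
      then show ?thesis using An(2) True by (simp add: A'_def)
    next
      case False
      then have "A i i = 0" using Suc.prems(3) i by simp
      \<comment> \<open>At an index already eliminated the diagonal entry is 0. The subtraction can
        only lower it, while positivity keeps it nonnegative, so the subtracted vector vanishes
        there.\<close>
      moreover have "0 \<le> A' i i"
        using pos' sform_delta[OF i(2) i(2), of A'] unfolding pos_def by metis
      ultimately have "(cmod (A i n))\<^sup>2 / Re (A n n) \<le> 0"
        by (simp add: A'_def uu less_eq_complex_def)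
      then have "A i n = 0" using An(1) by (simp add: divide_le_0_iff)
      then show ?thesis using \<open>A i i = 0\<close> by (simp add: A'_def u)
    qed
    then obtain w where w: "\<forall>i<d. \<forall>j<d. A' i j = (\<Sum>k<n. w k i * cnj (w k j))"
      using Suc.IH[OF pos'] n by auto
    then have "A i j = (\<Sum>k<n. w k i * cnj (w k j)) + u i * cnj (u j)" if "i < d" "j < d" for i j
    proof -
      have "A' i j = (\<Sum>k<n. w k i * cnj (w k j))" using w that by blast
      then show ?thesis by (simp add: A'_def algebra_simps)
    qed
    then show ?thesis by (intro exI[of _ "w(n := u)"]) simp
  qed
qed

lemma pos_cholesky:
  assumes "pos d A"
  obtains w where "\<And>i j. i < d \<Longrightarrow> j < d \<Longrightarrow> A i j = (\<Sum>k<d. w k i * cnj (w k j))"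
  using pos_cholesky_aux[OF assms, of d] by auto

text \<open>Splitting off the multiple of \<open>A x\<close> first makes a prescribed vector of the
  range one of the parts. It sits at index \<open>d\<close>, after the \<open>d\<close> parts of the
  remainder.\<close>

lemma pos_cholesky_pivot:
  assumes "pos d A" and "0 < Re (sform d A x x)"
  obtains w where "\<And>i j. i < d \<Longrightarrow> j < d \<Longrightarrow> A i j = (\<Sum>k<Suc d. w k i * cnj (w k j))"
    and "w d = (\<lambda>i. mv d A x i / of_real (sqrt (Re (sform d A x x))))"
proof -
  let ?u = "\<lambda>i. mv d A x i / of_real (sqrt (Re (sform d A x x)))"
  obtain w where w: "\<And>i j. i < d \<Longrightarrow> j < d \<Longrightarrow> A i j - ?u i * cnj (?u j) = (\<Sum>k<d. w k i * cnj (w k j))"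
    by (rule pos_cholesky[OF pos_minus_rank_one[OF assms refl]]) blast
  have "A i j = (\<Sum>k<Suc d. (w(d := ?u)) k i * cnj ((w(d := ?u)) k j))" if "i < d" "j < d" for i j
    using w[OF that] by (simp add: algebra_simps)
  then show thesis using that[of "w(d := ?u)"] by simp
qed

section \<open>The spectral theorem for Hermitian matrices\<close>

lemma hermitian_ip:
  assumes "\<And>i j. i < d \<Longrightarrow> j < d \<Longrightarrow> A j i = cnj (A i j)"
  shows "ip d (mv d A x) y = ip d x (mv d A y)"
proof -
  have "ip d (mv d A x) y = (\<Sum>j<d. \<Sum>i<d. A i j * x j * cnj (y i))"
    unfolding ip_def mv_def sum_distrib_right by (rule sum.swap)
  also have "\<dots> = (\<Sum>j<d. \<Sum>i<d. x j * cnj (A j i * y i))"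
  proof (intro sum.cong refl)
    fix i j assume "j \<in> {..<d}" "i \<in> {..<d}"
    then have "A i j = cnj (A j i)" using assms[of j i] by simp
    then show "A i j * x j * cnj (y i) = x j * cnj (A j i * y i)" by (simp add: mult.assoc mult.left_commute)
  qed
  also have "\<dots> = ip d x (mv d A y)"
    unfolding ip_def mv_def cnj_sum sum_distrib_left by simp
  finally show ?thesis .
qed

text \<open>The phase is fixed for the sake of the Householder reflection, which divides by
  \<open>1 - x 0\<close>: with \<open>x 0\<close> real and nonpositive this number is real and at
  least 1.\<close>

lemma hermitian_unit_eigenvector:
  assumes "0 < n" and herm: "\<And>i j. i < n \<Longrightarrow> j < n \<Longrightarrow> A j i = cnj (A i j)"
  obtains x :: "nat \<Rightarrow> complex" and r :: real where "sqn n x = 1" and "\<And>i. i < n \<Longrightarrow> mv n A x i = r * x i"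
    and "Im (x 0) = 0" and "Re (x 0) \<le> 0"
proof -
  let ?M = "mat n n (\<lambda>(i, j). A i j)"
  have M: "?M \<in> carrier_mat n n" by simp
  have "degree (char_poly ?M) = n" using degree_monic_char_poly[OF M] by simp
  then have "\<not> constant (poly (char_poly ?M))" using assms(1) by (simp add: constant_degree)
  then obtain k where "poly (char_poly ?M) k = 0" using fundamental_theorem_of_algebra by blast
  then have "eigenvalue ?M k" using eigenvalue_root_char_poly[OF M] by simp
  then obtain v where v: "v \<in> carrier_vec n" "v \<noteq> 0\<^sub>v n" "?M *\<^sub>v v = k \<cdot>\<^sub>v v"
    unfolding eigenvalue_def eigenvector_def by auto
  define y where "y = (\<lambda>i. v $ i)"
  have ev: "mv n A y i = k * y i" if "i < n" for i
  proof -
    have "mv n A y i = (?M *\<^sub>v v) $ i"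
      using that v(1) by (simp add: scalar_prod_def mv_def y_def lessThan_atLeast0)
    also have "\<dots> = k * y i"
      unfolding v(3) using that v(1) by (simp add: y_def)
    finally show ?thesis .
  qed
  have y0: "sqn n y \<noteq> 0"
  proof
    assume "sqn n y = 0"
    then have "v = 0\<^sub>v n" using v(1) by (intro eq_vecI) (auto simp: sqn_eq_0_iff y_def)
    then show False using v(2) by simp
  qed
  have "ip n (mv n A y) y = k * sqn n y"
    using ip_cong[of n "mv n A y" "\<lambda>i. k * y i" y y] ev by (simp add: ip_scale_left ip_self)
  moreover have "ip n y (mv n A y) = cnj k * sqn n y"
    using ip_cong[of n y y "mv n A y" "\<lambda>i. k * y i"] ev by (simp add: ip_scale_right ip_self)
  ultimately have "k = cnj k" using hermitian_ip[of n A y y, OF herm] y0 by simp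
  then have k: "k = of_real (Re k)" by (simp add: complex_eq_iff)
  \<comment> \<open>Normalises the vector and rotates its first coordinate onto the negative real
    axis; any phase will do if that coordinate is 0.\<close>
  define c where "c = (if y 0 = 0 then 1 else - cnj (y 0) / of_real (cmod (y 0))) / of_real (sqrt (sqn n y))"
  have c1: "(cmod c)\<^sup>2 = 1 / sqn n y"
    using sqn_nonneg[of n y] by (simp add: c_def norm_divide power_divide)
  have c2: "c * y 0 = of_real (- cmod (y 0) / sqrt (sqn n y))"
    by (simp add: c_def mult.commute[of "cnj _"] mult_cnj_of_real power2_eq_square)
  show thesis
  proof (rule that[of "\<lambda>i. c * y i" "Re k"])
    show "sqn n (\<lambda>i. c * y i) = 1" using y0 by (simp add: sqn_scale c1)
    show "mv n A (\<lambda>i. c * y i) i = of_real (Re k) * (c * y i)" if "i < n" for i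
      unfolding k[symmetric] using ev[OF that] by (simp add: mv_scale mult.left_commute)
    show "Im (c * y 0) = 0" "Re (c * y 0) \<le> 0" unfolding c2 by (simp_all add: sqn_nonneg)
  qed
qed

text \<open>Induction on the dimension: the Householder reflection exchanging the first basis vector
  with a unit eigenvector splits off a one-dimensional block.\<close>

lemma hermitian_spectral:
  assumes "\<And>i j. i < n \<Longrightarrow> j < n \<Longrightarrow> A j i = cnj (A i j)"
  shows "\<exists>(v :: nat \<Rightarrow> nat \<Rightarrow> complex) (l :: nat \<Rightarrow> real). (\<forall>i<n. \<forall>j<n. ip n (v i) (v j) = (if i = j then 1 else 0)) \<and>
    (\<forall>j<n. \<forall>i<n. mv n A (v j) i = of_real (l j) * v j i)"
  using assms
proof (induction n arbitrary: A)
  case 0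
  then show ?case by simp
next
  case (Suc m)
  let ?n = "Suc m"
  obtain x :: "nat \<Rightarrow> complex" and r :: real where x: "sqn ?n x = 1" and ev: "\<And>i. i < ?n \<Longrightarrow> mv ?n A x i = r * x i"
    and x0: "Im (x 0) = 0" "Re (x 0) \<le> 0"
    using hermitian_unit_eigenvector[of ?n A, OF zero_less_Suc Suc.prems] by blast
  define s :: complex where "s = of_real (1 - Re (x 0))"
  define z where "z = (\<lambda>i. x i - delta 0 i)"
  have x0': "x 0 = 1 - s" using x0 by (simp add: s_def complex_eq_iff)
  have s0: "s \<noteq> 0" using x0 by (auto simp: s_def complex_eq_iff)
  have cs: "cnj s = s" by (simp add: s_def)
  have z0: "z 0 = - s" by (simp add: z_def x0' delta_def)
  have zd: "ip ?n z (delta 0) = - s" by (simp add: ip_delta z0)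
  have zd': "ip ?n (delta 0) z = - s" using ip_commute[of ?n "delta 0" z] zd cs by simp
  have zz: "ip ?n z z = 2 * s"
  proof -
    have "ip ?n z z = ip ?n z x - ip ?n z (delta 0)"
      by (subst (2) z_def) (simp add: ip_diff_right)
    also have "ip ?n z x = 1 - ip ?n (delta 0) x"
      by (simp add: z_def ip_diff_left ip_self x)
    also have "ip ?n (delta 0) x = 1 - s"
      using ip_commute[of ?n "delta 0" x] x0' cs by (simp add: ip_delta)
    finally show ?thesis using zd by simp
  qed
  \<comment> \<open>The reflection along \<open>z\<close>: its usual coefficient 2 / |z|^2 is
    \<open>1 / s\<close>, because |z|^2 = 2 s.\<close>
  define R where "R = (\<lambda>y i. y i + (- (ip ?n y z / s)) * z i)"
  have ipR: "ip ?n (R y) w = ip ?n y w - ip ?n y z * ip ?n z w / s" for y w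
    unfolding R_def ip_add_left ip_scale_left by simp
  have Rz: "ip ?n (R y) z = - ip ?n y z" for y using s0 by (simp add: ipR zz)
  have RR: "R (R y) = y" for y
  proof
    fix i
    have "R (R y) i = R y i + (ip ?n y z / s) * z i"
      by (subst R_def) (simp add: Rz)
    then show "R (R y) i = y i" by (simp add: R_def)
  qed
  have Rsym: "ip ?n (R y) w = ip ?n y (R w)" for y w
    using ip_commute[of ?n y "R w"] ip_commute[of ?n y w] ip_commute[of ?n z w] ip_commute[of ?n y z]
    by (simp add: ipR cs)
  have Rip: "ip ?n (R y) (R w) = ip ?n y w" for y w by (simp add: Rsym RR)
  have Rd: "R (delta 0) = x"
  proof -
    have "R (delta 0) = (\<lambda>i. delta 0 i + z i)" using s0 by (simp add: R_def zd')
    then show ?thesis by (simp add: z_def)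
  qed
  have Rcong: "R y i = R w i" if "\<And>i. i < ?n \<Longrightarrow> y i = w i" "i < ?n" for y w i
    using that ip_cong[of ?n y w z z] by (simp add: R_def)
  have Rscale: "R (\<lambda>i. c * y i) = (\<lambda>i. c * R y i)" for c y
    by (rule ext) (simp add: R_def ip_scale_left algebra_simps)
  note herm = hermitian_ip[of ?n A, OF Suc.prems]
  \<comment> \<open>The matrix of \<open>A\<close> conjugated by \<open>R\<close>. By
    self-adjointness its row \<open>i\<close> consists of the conjugated coordinates of the image of
    \<open>delta i\<close>, so no matrix product has to be expanded.\<close>
  define B where "B = (\<lambda>i j. cnj (R (mv ?n A (R (delta i))) j))"
  have RAR: "R (mv ?n A (R y)) i = (\<Sum>j<?n. B i j * y j)" if "i < ?n" for y i
  proof -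
    have "R (mv ?n A (R y)) i = ip ?n (R (mv ?n A (R y))) (delta i)" using that by (simp add: ip_delta)
    also have "\<dots> = ip ?n y (R (mv ?n A (R (delta i))))" by (simp add: Rsym herm)
    finally show ?thesis by (simp only: ip_def B_def mult.commute)
  qed
  have Bherm: "B j i = cnj (B i j)" if "i < ?n" "j < ?n" for i j
  proof -
    have "cnj (B j i) = (\<Sum>k<?n. B i k * delta j k)" using RAR[OF that(1), of "delta j"] by (simp add: B_def)
    also have "\<dots> = B i j" using that(2) by (simp add: delta_def if_distrib cong: if_cong)
    finally show ?thesis by (metis complex_cnj_cnj)
  qed
  obtain v' :: "nat \<Rightarrow> nat \<Rightarrow> complex" and l' :: "nat \<Rightarrow> real"
    where v': "\<forall>i<m. \<forall>j<m. ip m (v' i) (v' j) = (if i = j then 1 else 0)"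
      and l': "\<forall>j<m. \<forall>i<m. mv m (\<lambda>i j. B (Suc i) (Suc j)) (v' j) i = of_real (l' j) * v' j i"
    using Suc.IH[of "\<lambda>i j. B (Suc i) (Suc j)", OF Bherm] by auto
  \<comment> \<open>Embeds the smaller space as the orthogonal complement of \<open>delta 0\<close>;
    \<open>R\<close> carries this complement to that of the eigenvector \<open>x\<close>.\<close>
  define em :: "(nat \<Rightarrow> complex) \<Rightarrow> nat \<Rightarrow> complex"
    where "em = (\<lambda>y i. case i of 0 \<Rightarrow> 0 | Suc i \<Rightarrow> y i)"
  have em_ip: "ip ?n (em y) (em w) = ip m y w" for y w
    unfolding ip_def sum.lessThan_Suc_shift by (simp add: em_def)
  have em0: "ip ?n (em y) (delta 0) = 0" "ip ?n (delta 0) (em y) = 0" for y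
    using ip_commute[of ?n "em y" "delta 0"] by (simp_all add: ip_delta em_def)
  have emev: "mv ?n A (R (em (v' j))) i = of_real (l' j) * R (em (v' j)) i" if "j < m" "i < ?n" for i j
  proof -
    have *: "R (mv ?n A (R (em (v' j)))) i = of_real (l' j) * em (v' j) i" if i: "i < ?n" for i
    proof (cases i)
      case 0
      \<comment> \<open>The first coordinate is an inner product with
        \<open>R (delta 0) = x\<close>. Moving \<open>A\<close> onto its eigenvector leaves a
        multiple of an inner product of orthogonal vectors.\<close>
      have "R (mv ?n A (R (em (v' j)))) 0 = ip ?n (R (em (v' j))) (mv ?n A x)"
        using ip_delta[of 0 ?n "R (mv ?n A (R (em (v' j))))"] by (simp add: Rsym herm Rd)
      also have "\<dots> = r * ip ?n (R (em (v' j))) x"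
        using ip_cong[of ?n "R (em (v' j))" "R (em (v' j))" "mv ?n A x" "\<lambda>i. r * x i"] ev
        by (simp add: ip_scale_right)
      also have "\<dots> = 0" unfolding Rd[symmetric] Rip by (simp add: em0)
      finally show ?thesis using 0 by (simp add: em_def)
    next
      case (Suc i')
      have "R (mv ?n A (R (em (v' j)))) i = mv m (\<lambda>i j. B (Suc i) (Suc j)) (v' j) i'"
        unfolding RAR[OF i] sum.lessThan_Suc_shift by (simp add: em_def Suc mv_def)
      then show ?thesis using l' i Suc \<open>j < m\<close> by (simp add: em_def)
    qed
    have "mv ?n A (R (em (v' j))) i = R (R (mv ?n A (R (em (v' j))))) i" by (simp only: RR)
    also have "\<dots> = R (\<lambda>i. of_real (l' j) * em (v' j) i) i" by (rule Rcong) (use * that in auto)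
    finally show ?thesis by (simp add: Rscale)
  qed
  define v where "v = (\<lambda>j. case j of 0 \<Rightarrow> x | Suc j \<Rightarrow> R (em (v' j)))"
  define l where "l = (\<lambda>j. case j of 0 \<Rightarrow> r | Suc j \<Rightarrow> l' j)"
  have "ip ?n (v i) (v j) = (if i = j then 1 else 0)" if "i < ?n" "j < ?n" for i j
  proof -
    have 1: "v i = R (case i of 0 \<Rightarrow> delta 0 | Suc i \<Rightarrow> em (v' i))" for i
      by (cases i) (simp_all add: v_def Rd)
    have 2: "ip ?n (delta 0) (delta 0) = 1" by (simp add: ip_delta) (simp add: delta_def)
    show ?thesis using that v' unfolding 1 Rip
      by (cases i; cases j) (simp_all add: em_ip em0 2)
  qed
  moreover have "mv ?n A (v j) i = of_real (l j) * v j i" if "j < ?n" "i < ?n" for i j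
    using that emev ev by (cases j) (simp_all add: v_def l_def)
  ultimately show ?case by blast
qed

section \<open>Schatten norms of traceless skew-Hermitian matrices\<close>

text \<open>\<open>\<i> C\<close> is Hermitian with real eigenvalues \<open>l j\<close>, so
  \<open>C\<close> multiplies \<open>v j\<close> by \<open>- \<i> l j\<close>. Since the adjoint of
  \<open>C\<close> is \<open>- C\<close>, the matrix whose characteristic polynomial defines the
  singular values is similar to the diagonal matrix of the squares of the
  \<open>l j\<close>.\<close>

lemma skew_hermitian_singular_values:
  assumes C: "C \<in> carrier_mat d d"
    and skew: "\<And>i j. i < d \<Longrightarrow> j < d \<Longrightarrow> C $$ (j, i) = - cnj (C $$ (i, j))"
  obtains v :: "nat \<Rightarrow> nat \<Rightarrow> complex" and l :: "nat \<Rightarrow> real"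
  where "\<And>i k. i < d \<Longrightarrow> k < d \<Longrightarrow> (\<Sum>j<d. v j i * cnj (v j k)) = (if i = k then 1 else 0)"
    and "\<And>j. j < d \<Longrightarrow> sform d (\<lambda>i k. C $$ (i, k)) (v j) (v j) = - (\<i> * of_real (l j))"
    and "singular_values C = image_mset (\<lambda>j. \<bar>l j\<bar>) (mset_set {..<d})"
proof -
  let ?C = "\<lambda>i j. C $$ (i, j)"
  have "\<i> * C $$ (j, i) = cnj (\<i> * C $$ (i, j))" if "i < d" "j < d" for i j
    using skew[OF that] by simp
  then obtain v :: "nat \<Rightarrow> nat \<Rightarrow> complex" and l :: "nat \<Rightarrow> real"
    where on: "\<forall>i<d. \<forall>j<d. ip d (v i) (v j) = (if i = j then 1 else 0)"
      and ev: "\<forall>j<d. \<forall>i<d. mv d (\<lambda>i j. \<i> * C $$ (i, j)) (v j) i = of_real (l j) * v j i"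
    using hermitian_spectral[of d "\<lambda>i j. \<i> * C $$ (i, j)"] by metis
  have Cv: "(\<Sum>k<d. C $$ (i, k) * v j k) = - (\<i> * of_real (l j)) * v j i" if "i < d" "j < d" for i j
  proof -
    have "\<i> * (\<Sum>k<d. C $$ (i, k) * v j k) = of_real (l j) * v j i"
      using ev that by (simp add: mv_def sum_distrib_left mult.assoc)
    then have "- \<i> * (\<i> * (\<Sum>k<d. C $$ (i, k) * v j k)) = - \<i> * (of_real (l j) * v j i)" by simp
    then show ?thesis by (simp add: mult.assoc[symmetric])
  qed
  define U where "U = mat d d (\<lambda>(i, j). v j i)"
  define V where "V = mat d d (\<lambda>(i, j). cnj (v i j))"
  define D where "D = mat d d (\<lambda>(i, j). if i = j then (of_real ((l j)\<^sup>2) :: complex) else 0)"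
  define N where "N = mat_adjoint C * C"
  have carr: "U \<in> carrier_mat d d" "V \<in> carrier_mat d d" "D \<in> carrier_mat d d" "N \<in> carrier_mat d d"
    using C by (auto simp: U_def V_def D_def N_def mat_adjoint_def)
  have adj: "mat_adjoint C = - C"
  proof (rule eq_matI)
    fix i j assume "i < dim_row (- C)" "j < dim_col (- C)"
    then have ij: "i < d" "j < d" using C by auto
    then have "mat_adjoint C $$ (i, j) = cnj (C $$ (j, i))"
      using C by (simp add: mat_adjoint_def mat_of_rows_def cols_nth)
    then show "mat_adjoint C $$ (i, j) = (- C) $$ (i, j)" using skew[OF ij] C ij by simp
  qed (use C in \<open>auto simp: mat_adjoint_def\<close>)
  have VU: "V * U = 1\<^sub>m d"
  proof (rule eq_matI)
    fix i j assume "i < dim_row (1\<^sub>m d :: complex mat)" "j < dim_col (1\<^sub>m d :: complex mat)"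
    then have ij: "i < d" "j < d" by auto
    then have "(V * U) $$ (i, j) = ip d (v j) (v i)"
      by (simp add: U_def V_def scalar_prod_def ip_def lessThan_atLeast0 mult.commute)
    then show "(V * U) $$ (i, j) = 1\<^sub>m d $$ (i, j)" using on ij by auto
  qed (use carr in auto)
  \<comment> \<open>A left inverse of a square matrix is a right inverse: this turns orthonormality
    of the eigenvectors into the completeness relation of the conclusion.\<close>
  then have UV: "U * V = 1\<^sub>m d" using mat_mult_left_right_inverse carr by blast
  have CU: "C * U = mat d d (\<lambda>(i, j). - (\<i> * of_real (l j)) * v j i)" (is "_ = ?CU")
  proof (rule eq_matI)
    fix i j assume "i < dim_row ?CU" "j < dim_col ?CU"
    then show "(C * U) $$ (i, j) = ?CU $$ (i, j)"
      using Cv C by (simp add: U_def scalar_prod_def lessThan_atLeast0)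
  qed (use C carr in auto)
  have "N * U = U * D"
  proof (rule eq_matI)
    fix i j assume "i < dim_row (U * D)" "j < dim_col (U * D)"
    then have ij: "i < d" "j < d" using carr by auto
    have "N * U = - C * ?CU" unfolding N_def adj CU[symmetric] using C carr
      by (intro assoc_mult_mat) auto
    then have "(N * U) $$ (i, j) = (\<Sum>k<d. - C $$ (i, k) * (- (\<i> * of_real (l j)) * v j k))"
      using ij C by (simp add: scalar_prod_def lessThan_atLeast0 sum_negf)
    also have "\<dots> = \<i> * of_real (l j) * (\<Sum>k<d. C $$ (i, k) * v j k)"
      by (simp add: sum_distrib_left algebra_simps)
    also have "\<dots> = of_real ((l j)\<^sup>2) * v j i"
      unfolding Cv[OF ij] by (simp add: power2_eq_square algebra_simps)
    also have "\<dots> = (U * D) $$ (i, j)"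
      using ij by (simp add: U_def D_def scalar_prod_def lessThan_atLeast0 if_distrib cong: if_cong)
    finally show "(N * U) $$ (i, j) = (U * D) $$ (i, j)" .
  qed (use carr in auto)
  then have "U * D * V = N * (U * V)" using assoc_mult_mat[of N d d U d V d] carr by simp
  then have "N = U * D * V" using UV carr by simp
  then have "similar_mat_wit N D U V"
    using carr UV VU by (auto simp: similar_mat_wit_def Let_def)
  then have "char_poly N = char_poly D"
    by (intro char_poly_similar) (auto simp: similar_mat_def)
  also have "\<dots> = (\<Prod>a\<leftarrow>diag_mat D. [:- a, 1:])"
    by (rule char_poly_upper_triangular[OF carr(3)]) (simp add: D_def upper_triangular_def)
  also have "diag_mat D = map (\<lambda>j. of_real ((l j)\<^sup>2)) [0..<d]"
    by (simp add: diag_mat_def D_def)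
  finally have cp: "char_poly N = (\<Prod>a\<leftarrow>map (\<lambda>j. of_real ((l j)\<^sup>2)) [0..<d]. [:- a, 1:])" .
  have proots: "proots (\<Prod>a\<leftarrow>as. [:- a, 1:]) = mset as" for as :: "complex list"
  proof (induction as)
    case (Cons a as)
    have "(\<Prod>a\<leftarrow>as. [:- a, 1:]) \<noteq> 0" by (simp add: prod_list_zero_iff image_iff)
    then have "proots ([:- a, 1:] * (\<Prod>a\<leftarrow>as. [:- a, 1:])) = {#a#} + mset as"
      using Cons by (subst proots_mult) auto
    then show ?case by simp
  qed simp
  have sv: "singular_values C = image_mset (\<lambda>j. \<bar>l j\<bar>) (mset_set {..<d})"
    unfolding singular_values_def N_def[symmetric] cp proots
    by (simp add: multiset.map_comp comp_def lessThan_atLeast0)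
  show thesis
  proof (rule that[of v l])
    show "(\<Sum>j<d. v j i * cnj (v j k)) = (if i = k then 1 else 0)" if "i < d" "k < d" for i k
    proof -
      have "(\<Sum>j<d. v j i * cnj (v j k)) = (U * V) $$ (i, k)"
        using that by (simp add: U_def V_def scalar_prod_def lessThan_atLeast0)
      then show ?thesis using UV that by simp
    qed
    show "sform d ?C (v j) (v j) = - (\<i> * of_real (l j))" if "j < d" for j
    proof -
      have "sform d ?C (v j) (v j) = ip d (\<lambda>i. - (\<i> * of_real (l j)) * v j i) (v j)"
        unfolding sform_def by (rule ip_cong) (use Cv that in \<open>simp_all add: mv_def\<close>)
      then show ?thesis using on that unfolding ip_scale_left by simp
    qed
    show "singular_values C = image_mset (\<lambda>j. \<bar>l j\<bar>) (mset_set {..<d})" by (rule sv)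
  qed
qed

text \<open>Since the numbers sum to zero, each absolute value is at most the sum of the others,
  hence at most \<open>S / 2\<close>, half of the total. Bounding all but one factor of each power
  by \<open>S / 2\<close> gives 2 (S / 2)^q, whose q-th root carries the factor 2^(1/q).\<close>

lemma schatten_norm_le_half_trace_norm:
  fixes l :: "nat \<Rightarrow> real"
  assumes "1 \<le> d" and "1 \<le> p" and sum0: "(\<Sum>j<d. l j) = 0"
    and sv: "singular_values C = image_mset (\<lambda>j. \<bar>l j\<bar>) (mset_set {..<d})"
  shows "schatten_norm p C \<le> two_root p * ((\<Sum>j<d. \<bar>l j\<bar>) / 2)"
proof -
  define S where "S = (\<Sum>j<d. \<bar>l j\<bar>)"
  have S0: "0 \<le> S" by (simp add: S_def sum_nonneg)
  have le: "\<bar>l j\<bar> \<le> S / 2" if "j < d" for j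
  proof -
    have "l j = - (\<Sum>i\<in>{..<d} - {j}. l i)"
      using sum.remove[of "{..<d}" j l] that sum0 by simp
    then have "\<bar>l j\<bar> \<le> (\<Sum>i\<in>{..<d} - {j}. \<bar>l i\<bar>)" using sum_abs[of l "{..<d} - {j}"] by simp
    moreover have "S = \<bar>l j\<bar> + (\<Sum>i\<in>{..<d} - {j}. \<bar>l i\<bar>)"
      unfolding S_def using sum.remove[of "{..<d}" j "\<lambda>j. \<bar>l j\<bar>"] that by simp
    ultimately show ?thesis by simp
  qed
  show ?thesis
  proof (cases "p = \<infinity>")
    case True
    have "Max ((\<lambda>j. \<bar>l j\<bar>) ` {..<d}) \<le> S / 2"
      using assms(1) le by (subst Max_le_iff) (auto simp: lessThan_empty_iff)
    then show ?thesis using True by (simp add: schatten_norm_def two_root_def sv S_def)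
  next
    case False
    define q where "q = real_of_ereal p"
    have q: "1 \<le> q" using assms(2) False unfolding q_def by (cases p) auto
    have "(\<Sum>j<d. \<bar>l j\<bar> powr q) \<le> (\<Sum>j<d. \<bar>l j\<bar> * (S / 2) powr (q - 1))"
    proof (rule sum_mono)
      fix j assume "j \<in> {..<d}"
      then have "\<bar>l j\<bar> * \<bar>l j\<bar> powr (q - 1) \<le> \<bar>l j\<bar> * (S / 2) powr (q - 1)"
        using le q by (intro mult_left_mono powr_mono2) auto
      moreover have "\<bar>l j\<bar> powr q = \<bar>l j\<bar> * \<bar>l j\<bar> powr (q - 1)"
        by (cases "l j = 0") (simp_all add: powr_diff)
      ultimately show "\<bar>l j\<bar> powr q \<le> \<bar>l j\<bar> * (S / 2) powr (q - 1)" by simp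
    qed
    also have "\<dots> = 2 * (S / 2) powr q"
      unfolding sum_distrib_right[symmetric] S_def[symmetric]
      using S0 by (cases "S = 0") (simp_all add: powr_diff)
    finally have "(\<Sum>j<d. \<bar>l j\<bar> powr q) powr (1 / q) \<le> (2 * (S / 2) powr q) powr (1 / q)"
      using q by (intro powr_mono2) (auto simp: sum_nonneg)
    also have "\<dots> = 2 powr (1 / q) * (S / 2)"
      using q S0 by (simp add: powr_mult powr_powr)
    finally have "(\<Sum>j<d. \<bar>l j\<bar> powr q) powr (1 / q) \<le> 2 powr (1 / q) * (S / 2)" .
    then show ?thesis using False
      by (simp add: schatten_norm_def two_root_def sv S_def q_def[symmetric] multiset.map_comp
          comp_def sum_unfold_sum_mset[symmetric])
  qed
qed

section \<open>Commutators of sums of rank-one operators\<close>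

text \<open>Only the resolution of the identity enters, not orthogonality, so the lemma serves
  eigenbases and overcomplete refinements of measurements alike.\<close>

lemma parseval:
  assumes "\<And>i k. i < d \<Longrightarrow> k < d \<Longrightarrow> (\<Sum>j\<in>J. v j i * cnj (v j k)) = (if i = k then 1 else 0)"
  shows "(\<Sum>j\<in>J. ip d x (v j) * cnj (ip d y (v j))) = ip d x y"
proof -
  have "(\<Sum>j\<in>J. ip d x (v j) * cnj (ip d y (v j))) = (\<Sum>j\<in>J. ip d (\<lambda>i. ip d x (v j) * v j i) y)"
    unfolding ip_scale_left ip_commute[of d _ y, symmetric] ..
  also have "\<dots> = ip d (\<lambda>i. \<Sum>j\<in>J. ip d x (v j) * v j i) y"
    by (rule ip_sum_left[symmetric])
  also have "\<dots> = ip d x y"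
  proof (rule ip_cong)
    fix i assume i: "i < d"
    have "(\<Sum>j\<in>J. ip d x (v j) * v j i) = (\<Sum>j\<in>J. \<Sum>k<d. x k * (v j i * cnj (v j k)))"
      by (simp add: ip_def sum_distrib_left sum_distrib_right algebra_simps)
    also have "\<dots> = (\<Sum>k<d. x k * (\<Sum>j\<in>J. v j i * cnj (v j k)))"
      unfolding sum_distrib_left by (rule sum.swap)
    also have "\<dots> = (\<Sum>k<d. if i = k then x k else 0)"
      using i assms by (intro sum.cong) auto
    finally show "(\<Sum>j\<in>J. ip d x (v j) * v j i) = x i" using i by simp
  qed simp
  finally show ?thesis .
qed

lemma parseval_sqn:
  assumes "\<And>i k. i < d \<Longrightarrow> k < d \<Longrightarrow> (\<Sum>j\<in>J. v j i * cnj (v j k)) = (if i = k then 1 else 0)"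
  shows "(\<Sum>j\<in>J. (cmod (ip d x (v j)))\<^sup>2) = sqn d x"
proof -
  have "complex_of_real (\<Sum>j\<in>J. (cmod (ip d x (v j)))\<^sup>2) = of_real (sqn d x)"
    using parseval[where x=x and y=x, OF assms] unfolding ip_self mult_cnj_of_real by simp
  then show ?thesis by (simp only: of_real_eq_iff)
qed

lemma parseval_trace:
  assumes "\<And>i k. i < d \<Longrightarrow> k < d \<Longrightarrow> (\<Sum>j\<in>J. v j i * cnj (v j k)) = (if i = k then 1 else 0)"
  shows "(\<Sum>j\<in>J. sqn d (v j)) = real d"
proof -
  have "complex_of_real (\<Sum>j\<in>J. sqn d (v j)) = (\<Sum>j\<in>J. \<Sum>i<d. v j i * cnj (v j i))"
    by (simp add: ip_self[symmetric] ip_def)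
  also have "\<dots> = (\<Sum>i<d. \<Sum>j\<in>J. v j i * cnj (v j i))" by (rule sum.swap)
  also have "\<dots> = of_real (real d)" using assms by simp
  finally show ?thesis by (simp only: of_real_eq_iff)
qed

text \<open>Half the trace norm of the commutator of the rank-one operators of \<open>w\<close> and
  \<open>u\<close>: the modulus of the overlap times the area of the parallelogram spanned by the
  two vectors.\<close>

definition overlap_area :: "nat \<Rightarrow> (nat \<Rightarrow> complex) \<Rightarrow> (nat \<Rightarrow> complex) \<Rightarrow> real" where
  "overlap_area d w u = cmod (ip d w u) * sqrt (sqn d w * sqn d u - (cmod (ip d w u))\<^sup>2)"

text \<open>The part of \<open>a\<close> along \<open>b\<close> contributes a real number, because
  the weights \<open>e j\<close> are real. Only the part orthogonal to \<open>b\<close> reaches the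
  imaginary part, and weights of modulus at most 1 do not increase its norm, so Cauchy-Schwarz
  produces the area.\<close>

lemma abs_Im_signed_ip_le:
  fixes e :: "nat \<Rightarrow> real"
  assumes e: "\<And>j. \<bar>e j\<bar> \<le> 1"
  shows "\<bar>Im (ip d b a * (\<Sum>j<d. of_real (e j) * a j * cnj (b j)))\<bar> \<le> overlap_area d a b"
proof (cases "sqn d b = 0")
  case True
  then have "b j = 0" if "j < d" for j using that by (simp add: sqn_eq_0_iff)
  then have "(\<Sum>j<d. of_real (e j) * a j * cnj (b j)) = 0" by simp
  then show ?thesis using cauchy_schwarz[of d a b] by (simp add: overlap_area_def)
next
  case False
  define \<beta> where "\<beta> = sqn d b"
  have \<beta>: "0 < \<beta>" using False sqn_nonneg[of d b] by (simp add: \<beta>_def)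
  define T where "T = (\<lambda>x y. ip d (\<lambda>j. of_real (e j) * x j) y)"
  \<comment> \<open>The component of \<open>a\<close> orthogonal to \<open>b\<close>, multiplied by
    \<beta> to avoid division.\<close>
  define a' where "a' = (\<lambda>j. of_real \<beta> * a j - ip d a b * b j)"
  have "T a' b = of_real \<beta> * T a b - ip d a b * T b b"
  proof -
    have "(\<lambda>j. of_real (e j) * a' j)
        = (\<lambda>j. of_real \<beta> * (of_real (e j) * a j) - ip d a b * (of_real (e j) * b j))"
      by (rule ext) (simp add: a'_def algebra_simps)
    then show ?thesis by (simp only: T_def ip_diff_left ip_scale_left)
  qed
  then have "ip d b a * T a' b = of_real \<beta> * (ip d b a * T a b) - of_real ((cmod (ip d a b))\<^sup>2) * T b b"
    by (simp only: ip_commute[of d b a] mult_cnj_of_real[symmetric]) (simp only: algebra_simps)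
  moreover have "Im (T b b) = 0"
    unfolding T_def ip_def by (simp add: mult.assoc mult_cnj_of_real)
  ultimately have 1: "\<beta> * Im (ip d b a * T a b) = Im (ip d b a * T a' b)" by simp
  have "ip d a' b = of_real \<beta> * ip d a b - ip d a b * ip d b b"
    unfolding a'_def by (simp only: ip_diff_left ip_scale_left)
  then have "ip d a' b = 0" by (simp add: ip_self \<beta>_def)
  then have "ip d a' a' = of_real \<beta> * ip d a' a"
    by (subst (2) a'_def) (simp add: ip_diff_right ip_scale_right)
  also have "ip d a' a = of_real \<beta> * of_real (sqn d a) - of_real ((cmod (ip d a b))\<^sup>2)"
    by (simp add: a'_def ip_diff_left ip_scale_left ip_self ip_commute[of d b a] mult_cnj_of_real del: of_real_power)
  finally have "complex_of_real (sqn d a') = of_real (\<beta> * (sqn d a * \<beta> - (cmod (ip d a b))\<^sup>2))"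
    by (simp add: ip_self mult.commute del: of_real_power)
  then have a': "sqn d a' = \<beta> * (sqn d a * \<beta> - (cmod (ip d a b))\<^sup>2)"
    by (simp only: of_real_eq_iff)
  have "sqn d (\<lambda>j. of_real (e j) * a' j) \<le> sqn d a'"
    unfolding sqn_def
  proof (rule sum_mono)
    fix j
    have "(e j)\<^sup>2 * (cmod (a' j))\<^sup>2 \<le> 1 * (cmod (a' j))\<^sup>2"
      using e[of j] by (intro mult_right_mono) (auto simp: abs_square_le_1)
    then show "(cmod (of_real (e j) * a' j))\<^sup>2 \<le> (cmod (a' j))\<^sup>2"
      by (simp add: norm_mult power_mult_distrib)
  qed
  then have "sqn d (\<lambda>j. of_real (e j) * a' j) * \<beta> \<le> sqn d a' * \<beta>"
    using \<beta> by (intro mult_right_mono) auto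
  then have "(cmod (T a' b))\<^sup>2 \<le> \<beta>\<^sup>2 * (sqn d a * \<beta> - (cmod (ip d a b))\<^sup>2)"
    using cauchy_schwarz[of d "\<lambda>j. of_real (e j) * a' j" b]
    unfolding T_def a' \<beta>_def by (simp add: power2_eq_square algebra_simps)
  then have 2: "cmod (T a' b) \<le> \<beta> * sqrt (sqn d a * \<beta> - (cmod (ip d a b))\<^sup>2)"
    using \<beta> real_le_rsqrt by (fastforce simp: real_sqrt_mult)
  have "\<beta> * \<bar>Im (ip d b a * T a b)\<bar> = \<bar>Im (ip d b a * T a' b)\<bar>"
    unfolding 1[symmetric] using \<beta> by (simp only: abs_mult abs_of_pos)
  also have "\<dots> \<le> cmod (ip d a b) * cmod (T a' b)"
    using abs_Im_le_cmod[of "ip d b a * T a' b"] by (simp add: norm_mult cmod_ip_commute[of d b a])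
  also have "\<dots> \<le> \<beta> * overlap_area d a b"
    using mult_left_mono[OF 2, of "cmod (ip d a b)"] by (simp add: overlap_area_def \<beta>_def mult.left_commute)
  finally show ?thesis using \<beta> by (simp add: T_def ip_def)
qed

lemma rank_one_sums_mult:
  "(\<Sum>t<d. (\<Sum>k\<in>A. f k i * cnj (f k t)) * (\<Sum>m\<in>B. g m t * cnj (g m j)))
    = (\<Sum>k\<in>A. \<Sum>m\<in>B. ip d (g m) (f k) * (f k i * cnj (g m j)))"
proof -
  have "(\<Sum>t<d. (\<Sum>k\<in>A. f k i * cnj (f k t)) * (\<Sum>m\<in>B. g m t * cnj (g m j)))
      = (\<Sum>k\<in>A. \<Sum>t<d. \<Sum>m\<in>B. (f k i * cnj (f k t)) * (g m t * cnj (g m j)))"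
    unfolding sum_product by (rule sum.swap)
  also have "\<dots> = (\<Sum>k\<in>A. \<Sum>m\<in>B. \<Sum>t<d. (f k i * cnj (f k t)) * (g m t * cnj (g m j)))"
    by (intro sum.cong refl sum.swap)
  also have "\<dots> = (\<Sum>k\<in>A. \<Sum>m\<in>B. ip d (g m) (f k) * (f k i * cnj (g m j)))"
    unfolding ip_def sum_distrib_right by (intro sum.cong refl) (simp only: mult_ac)
  finally show ?thesis .
qed

text \<open>Once the signs of the eigenvalues are fixed, the trace norm is a linear functional of
  the commutator. It therefore splits over the pairs of rank-one parts, and each pair is bounded
  separately with the same signs.\<close>

lemma commutator_schatten_norm_le:
  assumes d: "1 \<le> d" and p: "1 \<le> p"
    and E: "E \<in> carrier_mat d d" "\<And>i j. i < d \<Longrightarrow> j < d \<Longrightarrow> E $$ (i, j) = (\<Sum>k\<in>K. w k i * cnj (w k j))"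
    and F: "F \<in> carrier_mat d d" "\<And>i j. i < d \<Longrightarrow> j < d \<Longrightarrow> F $$ (i, j) = (\<Sum>m\<in>M. u m i * cnj (u m j))"
  shows "schatten_norm p (commutator E F) \<le> two_root p * (\<Sum>k\<in>K. \<Sum>m\<in>M. overlap_area d (w k) (u m))"
proof -
  let ?C = "commutator E F"
  define T where "T = (\<lambda>k m i j. ip d (u m) (w k) * (w k i * cnj (u m j)) - ip d (w k) (u m) * (u m i * cnj (w k j)))"
  have C: "?C \<in> carrier_mat d d"
    unfolding commutator_def by (rule minus_carrier_mat) (use E(1) F(1) in auto)
  have entries: "?C $$ (i, j) = (\<Sum>k\<in>K. \<Sum>m\<in>M. T k m i j)" if ij: "i < d" "j < d" for i j
  proof -
    have "?C $$ (i, j) = (\<Sum>t<d. E $$ (i, t) * F $$ (t, j)) - (\<Sum>t<d. F $$ (i, t) * E $$ (t, j))"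
      unfolding commutator_def using ij E(1) F(1) by (simp add: scalar_prod_def lessThan_atLeast0)
    also have "(\<Sum>t<d. E $$ (i, t) * F $$ (t, j))
        = (\<Sum>t<d. (\<Sum>k\<in>K. w k i * cnj (w k t)) * (\<Sum>m\<in>M. u m t * cnj (u m j)))"
      using ij E(2) F(2) by (intro sum.cong) auto
    also have "\<dots> = (\<Sum>k\<in>K. \<Sum>m\<in>M. ip d (u m) (w k) * (w k i * cnj (u m j)))"
      by (rule rank_one_sums_mult)
    also have "(\<Sum>t<d. F $$ (i, t) * E $$ (t, j))
        = (\<Sum>t<d. (\<Sum>m\<in>M. u m i * cnj (u m t)) * (\<Sum>k\<in>K. w k t * cnj (w k j)))"
      using ij E(2) F(2) by (intro sum.cong) auto
    also have "\<dots> = (\<Sum>m\<in>M. \<Sum>k\<in>K. ip d (w k) (u m) * (u m i * cnj (w k j)))"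
      by (rule rank_one_sums_mult)
    also have "\<dots> = (\<Sum>k\<in>K. \<Sum>m\<in>M. ip d (w k) (u m) * (u m i * cnj (w k j)))"
      by (rule sum.swap)
    finally show ?thesis by (simp add: T_def sum_subtractf)
  qed
  have Tskew: "T k m j i = - cnj (T k m i j)" for k m i j
    using ip_commute[of d "u m" "w k"] by (simp add: T_def mult.commute)
  have skew: "?C $$ (j, i) = - cnj (?C $$ (i, j))" if "i < d" "j < d" for i j
    unfolding entries[OF that] entries[OF that(2,1)] Tskew[of _ _ j i] cnj_sum by (simp add: sum_negf)
  obtain v l where complete: "\<And>i k. i < d \<Longrightarrow> k < d \<Longrightarrow> (\<Sum>j<d. v j i * cnj (v j k)) = (if i = k then 1 else 0)"
    and vl: "\<And>j. j < d \<Longrightarrow> sform d (\<lambda>i k. ?C $$ (i, k)) (v j) (v j) = - (\<i> * of_real (l j))"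
    and sv: "singular_values ?C = image_mset (\<lambda>j. \<bar>l j\<bar>) (mset_set {..<d})"
    using skew_hermitian_singular_values[OF C skew] by blast
  \<comment> \<open>The commutator of one pair of parts has the value \<open>z - cnj z\<close> at
    the eigenvector \<open>v j\<close>, so only the imaginary part of \<open>z\<close>
    survives.\<close>
  define z where "z = (\<lambda>k m j. ip d (u m) (w k) * (ip d (w k) (v j) * cnj (ip d (u m) (v j))))"
  have l: "l j = - 2 * (\<Sum>k\<in>K. \<Sum>m\<in>M. Im (z k m j))" if j: "j < d" for j
  proof -
    have "sform d (\<lambda>i k. ?C $$ (i, k)) (v j) (v j) = (\<Sum>k\<in>K. \<Sum>m\<in>M. sform d (T k m) (v j) (v j))"
      unfolding sform_sum_kernel[symmetric] by (rule sform_cong) (simp_all add: entries)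
    also have "\<dots> = (\<Sum>k\<in>K. \<Sum>m\<in>M. 2 * \<i> * of_real (Im (z k m j)))"
    proof (intro sum.cong refl)
      fix k m
      have "sform d (T k m) (v j) (v j) = z k m j - cnj (z k m j)"
        using ip_commute[of d "u m" "w k"] ip_commute[of d "u m" "v j"] ip_commute[of d "w k" "v j"]
        by (simp add: T_def sform_diff_kernel sform_scale_kernel sform_rank_one z_def mult.commute)
      then show "sform d (T k m) (v j) (v j) = 2 * \<i> * of_real (Im (z k m j))"
        by (simp add: complex_eq_iff)
    qed
    finally have "- (\<i> * of_real (l j)) = \<i> * of_real (2 * (\<Sum>k\<in>K. \<Sum>m\<in>M. Im (z k m j)))"
      unfolding vl[OF j] by (simp add: sum_distrib_left algebra_simps)
    then show ?thesis by (simp add: complex_eq_iff)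
  qed
  \<comment> \<open>Stated for arbitrary weights because it is used twice: weights 1 show that the
    trace vanishes, weights \<open>sgn (l j)\<close> give the trace norm.\<close>
  have signed: "(\<Sum>j<d. e j * l j) = - 2 * (\<Sum>k\<in>K. \<Sum>m\<in>M. Im (ip d (u m) (w k) *
      (\<Sum>j<d. of_real (e j) * ip d (w k) (v j) * cnj (ip d (u m) (v j)))))" for e :: "nat \<Rightarrow> real"
  proof -
    have "(\<Sum>j<d. e j * l j) = (\<Sum>j<d. - 2 * (\<Sum>k\<in>K. \<Sum>m\<in>M. Im (of_real (e j) * z k m j)))"
      using l by (intro sum.cong refl) (simp add: sum_distrib_left mult.left_commute)
    also have "\<dots> = - 2 * (\<Sum>k\<in>K. \<Sum>m\<in>M. \<Sum>j<d. Im (of_real (e j) * z k m j))"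
      unfolding sum_distrib_left[symmetric]
      by (subst sum.swap, intro arg_cong[of _ _ "\<lambda>x. - 2 * x"] sum.cong refl sum.swap)
    also have "\<dots> = - 2 * (\<Sum>k\<in>K. \<Sum>m\<in>M. Im (\<Sum>j<d. of_real (e j) * z k m j))"
      by (simp only: Im_sum)
    finally show ?thesis by (simp only: z_def sum_distrib_left mult_ac)
  qed
  have pars: "(\<Sum>j<d. ip d x (v j) * cnj (ip d y (v j))) = ip d x y" for x y
    using parseval complete by blast
  have "(\<Sum>j<d. l j) = (\<Sum>j<d. 1 * l j)" by simp
  also have "\<dots> = 0"
    unfolding signed using pars ip_commute[of d "u _" "w _"] by (simp add: mult_cnj_of_real mult.commute)
  finally have sum0: "(\<Sum>j<d. l j) = 0" .
  have "(\<Sum>j<d. \<bar>l j\<bar>) = (\<Sum>j<d. sgn (l j) * l j)"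
    by (intro sum.cong refl) (simp add: abs_sgn mult.commute)
  also have "\<dots> \<le> 2 * (\<Sum>k\<in>K. \<Sum>m\<in>M. overlap_area d (w k) (u m))"
  proof -
    have "- Im (ip d (u m) (w k) * (\<Sum>j<d. of_real (sgn (l j)) * ip d (w k) (v j) * cnj (ip d (u m) (v j))))
        \<le> overlap_area d (w k) (u m)" for k m
    proof -
      \<comment> \<open>Passing to coordinates in the eigenbasis preserves inner products, so the
        signs become diagonal weights without changing the overlap area.\<close>
      have co: "ip d (\<lambda>j. ip d x (v j)) (\<lambda>j. ip d y (v j)) = ip d x y" for x y
        unfolding ip_def[of d "\<lambda>j. ip d x (v j)"] by (rule pars)
      have "sqn d (\<lambda>j. ip d x (v j)) = sqn d x" for x
        using co[of x x] by (simp add: ip_self)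
      then show ?thesis
        using abs_Im_signed_ip_le[of "\<lambda>j. sgn (l j)" d "\<lambda>j. ip d (u m) (v j)" "\<lambda>j. ip d (w k) (v j)"]
        unfolding overlap_area_def co by (simp add: abs_sgn_eq)
    qed
    then have "(\<Sum>k\<in>K. \<Sum>m\<in>M. - Im (ip d (u m) (w k) * (\<Sum>j<d. of_real (sgn (l j)) * ip d (w k) (v j) * cnj (ip d (u m) (v j)))))
        \<le> (\<Sum>k\<in>K. \<Sum>m\<in>M. overlap_area d (w k) (u m))"
      by (intro sum_mono)
    then show ?thesis unfolding signed sum_negf by simp
  qed
  finally have "(\<Sum>j<d. \<bar>l j\<bar>) / 2 \<le> (\<Sum>k\<in>K. \<Sum>m\<in>M. overlap_area d (w k) (u m))" by simp
  moreover have "0 \<le> two_root p" by (simp add: two_root_def)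
  ultimately show ?thesis
    using schatten_norm_le_half_trace_norm[OF d p sum0 sv] mult_left_mono by (meson order_trans)
qed

section \<open>Pairs maximising the incompatibility\<close>

abbreviation (input) entry :: "complex mat \<Rightarrow> nat \<Rightarrow> nat \<Rightarrow> complex" where
  "entry A \<equiv> \<lambda>i j. A $$ (i, j)"

section \<open>Matrices, measurements and their kernels\<close>

lemma psd_iff: "psd d A \<longleftrightarrow> A \<in> carrier_mat d d \<and> pos d (entry A)"
proof (cases "A \<in> carrier_mat d d")
  case A: True
  have *: "(A *\<^sub>v v) \<bullet>c v = sform d (entry A) (\<lambda>i. v $ i) (\<lambda>i. v $ i)" if "v \<in> carrier_vec d" for v
    using A that by (simp add: scalar_prod_def sform_def ip_def mv_def lessThan_atLeast0)
  have "pos d (entry A)" if "\<forall>v\<in>carrier_vec d. 0 \<le> (A *\<^sub>v v) \<bullet>c v"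
    unfolding pos_def
  proof
    fix x
    have "0 \<le> (A *\<^sub>v vec d x) \<bullet>c vec d x" using that by simp
    also have "\<dots> = sform d (entry A) x x"
      unfolding *[OF vec_carrier] by (rule sform_cong) simp_all
    finally show "0 \<le> sform d (entry A) x x" .
  qed
  then show ?thesis using * A unfolding psd_def pos_def by auto
qed (simp add: psd_def)

lemma mat_sum_carrier: "mat_sum d A I \<in> carrier_mat d d"
  by (simp add: mat_sum_def)

lemma mat_sum_eq_one_iff:
  "mat_sum d A I = 1\<^sub>m d \<longleftrightarrow> (\<forall>i<d. \<forall>j<d. (\<Sum>k\<in>I. A k $$ (i, j)) = (if i = j then 1 else 0))"
  unfolding mat_sum_def by (auto simp: mat_eq_iff)

lemma loewner_le_iff:
  assumes "B \<in> carrier_mat d d"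
  shows "loewner_le d (complex_of_real \<eta> \<cdot>\<^sub>m B) (mat_sum d A I) \<longleftrightarrow>
    pos d (\<lambda>i j. (\<Sum>k\<in>I. A k $$ (i, j)) - of_real \<eta> * B $$ (i, j))"
proof -
  let ?D = "mat_sum d A I - complex_of_real \<eta> \<cdot>\<^sub>m B"
  have D: "?D \<in> carrier_mat d d"
    by (rule minus_carrier_mat) (use assms in auto)
  have "sform d (entry ?D) x x = sform d (\<lambda>i j. (\<Sum>k\<in>I. A k $$ (i, j)) - of_real \<eta> * B $$ (i, j)) x x" for x
    using assms by (intro sform_cong) (simp_all add: mat_sum_def)
  then show ?thesis using assms D mat_sum_carrier[of d A I]
    by (simp add: loewner_le_def psd_iff pos_def)
qed

lemma measurementD:
  assumes "measurement d n E"
  shows "a \<in> {1..n} \<Longrightarrow> E a \<in> carrier_mat d d"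
    and "a \<in> {1..n} \<Longrightarrow> pos d (entry (E a))"
    and "a \<in> {1..n} \<Longrightarrow> E a \<noteq> 0\<^sub>m d d"
    and "i < d \<Longrightarrow> j < d \<Longrightarrow> (\<Sum>a\<in>{1..n}. E a $$ (i, j)) = (if i = j then 1 else 0)"
  using assms by (auto simp: measurement_def psd_iff mat_sum_eq_one_iff)

text \<open>The scalar \<open>c\<close> and a padding zero vector cover the case
  \<open>A x = 0\<close>, so every effect gets the same number \<open>Suc d\<close> of parts, with
  the prescribed direction always at index \<open>d\<close>.\<close>

lemma pos_decomposition:
  assumes "pos d A"
  shows "\<exists>w c. (\<forall>i<d. \<forall>j<d. A i j = (\<Sum>k<Suc d. w k i * cnj (w k j))) \<and>
    (\<forall>i<d. mv d A x i = of_real c * w d i)"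
proof (cases "0 < Re (sform d A x x)")
  case True
  obtain w where w: "\<And>i j. i < d \<Longrightarrow> j < d \<Longrightarrow> A i j = (\<Sum>k<Suc d. w k i * cnj (w k j))"
    and "w d = (\<lambda>i. mv d A x i / of_real (sqrt (Re (sform d A x x))))"
    using pos_cholesky_pivot[OF assms True] by blast
  then have "mv d A x i = of_real (sqrt (Re (sform d A x x))) * w d i" for i
    using True by simp
  then show ?thesis using w by blast
next
  case False
  then have "Re (sform d A x x) = 0" using posD(1)[OF assms, of x] by simp
  \<comment> \<open>Testing Cauchy-Schwarz against \<open>A x\<close> itself turns the vanishing of
    the form at \<open>x\<close> into the vanishing of \<open>A x\<close>.\<close>
  then have "sform d A x (mv d A x) = 0"
    using pos_cauchy_schwarz[OF assms, of x "mv d A x"] by simp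
  then have "\<forall>i<d. mv d A x i = 0"
    unfolding sform_def ip_self by (simp add: sqn_eq_0_iff)
  moreover obtain w where "\<And>i j. i < d \<Longrightarrow> j < d \<Longrightarrow> A i j = (\<Sum>k<d. w k i * cnj (w k j))"
    using pos_cholesky[OF assms] by blast
  ultimately show ?thesis by (intro exI[of _ "w(d := \<lambda>_. 0)"] exI[of _ 0]) simp
qed

text \<open>The sum of squares measures the defect in the inequality of arithmetic and geometric means
  that bounds the concave function sqrt (x (1 - x)) by its tangent at x = 1 / d.\<close>

lemma overlap_area_sum:
  assumes I: "\<And>i j. i < d \<Longrightarrow> j < d \<Longrightarrow> (\<Sum>k\<in>I. w k i * cnj (w k j)) = (if i = j then 1 else 0)"
    and J: "\<And>i j. i < d \<Longrightarrow> j < d \<Longrightarrow> (\<Sum>m\<in>J. u m i * cnj (u m j)) = (if i = j then 1 else 0)"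
    and d: "1 \<le> d"
  shows "2 * sqrt (real d - 1) * (\<Sum>k\<in>I. \<Sum>m\<in>J. overlap_area d (w k) (u m)) =
    2 * real d * (real d - 1) - (\<Sum>k\<in>I. \<Sum>m\<in>J. (sqrt (real d - 1) * cmod (ip d (w k) (u m))
      - sqrt (sqn d (w k) * sqn d (u m) - (cmod (ip d (w k) (u m)))\<^sup>2))\<^sup>2)"
proof -
  let ?m = "\<lambda>k m. (cmod (ip d (w k) (u m)))\<^sup>2" and ?c = "\<lambda>k m. sqn d (w k) * sqn d (u m)"
  \<comment> \<open>This is 2 r q = r^2 + q^2 - (r - q)^2, where r is sqrt (d - 1) times the modulus
    of the overlap and q is the area.\<close>
  have termwise: "2 * sqrt (real d - 1) * overlap_area d (w k) (u m) = (real d - 2) * ?m k m + ?c k m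
      - (sqrt (real d - 1) * cmod (ip d (w k) (u m)) - sqrt (?c k m - ?m k m))\<^sup>2" for k m
    using d cauchy_schwarz[of d "w k" "u m"]
    by (simp add: overlap_area_def power2_diff power_mult_distrib algebra_simps)
  have m: "(\<Sum>k\<in>I. \<Sum>m\<in>J. ?m k m) = real d"
    by (simp add: parseval_sqn[OF J] parseval_trace[OF I])
  have c: "(\<Sum>k\<in>I. \<Sum>m\<in>J. ?c k m) = real d * real d"
  proof -
    have "(\<Sum>k\<in>I. \<Sum>m\<in>J. ?c k m) = (\<Sum>k\<in>I. sqn d (w k)) * (\<Sum>m\<in>J. sqn d (u m))"
      by (rule sum_product[symmetric])
    also have "(\<Sum>k\<in>I. sqn d (w k)) = real d" by (rule parseval_trace) (rule I)
    also have "(\<Sum>m\<in>J. sqn d (u m)) = real d" by (rule parseval_trace) (rule J)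
    finally show ?thesis .
  qed
  have m': "(\<Sum>k\<in>I. \<Sum>m\<in>J. (real d - 2) * ?m k m) = (real d - 2) * real d"
    by (simp only: sum_distrib_left[symmetric] m)
  show ?thesis
    unfolding sum_distrib_left termwise sum_subtractf sum.distrib m' c by (simp add: algebra_simps)
qed

text \<open>Maximality leaves no room for the squared defects, so each of them is 0. The case
  \<open>d = 1\<close> needs no separate treatment: the factor sqrt (d - 1) is then 0, and
  \<open>overlap_area_sum\<close> itself says that the defects sum to 0.\<close>

lemma overlap_area_sum_max:
  assumes I: "\<And>i j. i < d \<Longrightarrow> j < d \<Longrightarrow> (\<Sum>k\<in>I. w k i * cnj (w k j)) = (if i = j then 1 else 0)"
    and J: "\<And>i j. i < d \<Longrightarrow> j < d \<Longrightarrow> (\<Sum>m\<in>J. u m i * cnj (u m j)) = (if i = j then 1 else 0)"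
    and d: "1 \<le> d" and fin: "finite I" "finite J"
    and max: "real d * sqrt (real d - 1) \<le> (\<Sum>k\<in>I. \<Sum>m\<in>J. overlap_area d (w k) (u m))"
    and km: "k \<in> I" "m \<in> J"
  shows "real d * (cmod (ip d (w k) (u m)))\<^sup>2 = sqn d (w k) * sqn d (u m)"
proof -
  let ?t = "\<lambda>k m. (sqrt (real d - 1) * cmod (ip d (w k) (u m))
      - sqrt (sqn d (w k) * sqn d (u m) - (cmod (ip d (w k) (u m)))\<^sup>2))\<^sup>2"
  have "2 * sqrt (real d - 1) * (real d * sqrt (real d - 1)) = 2 * real d * (real d - 1)"
    using d by (simp add: mult.assoc mult.left_commute)
  moreover have "2 * sqrt (real d - 1) * (real d * sqrt (real d - 1))
      \<le> 2 * sqrt (real d - 1) * (\<Sum>k\<in>I. \<Sum>m\<in>J. overlap_area d (w k) (u m))"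
    using max d by (intro mult_left_mono) auto
  ultimately have "(\<Sum>k\<in>I. \<Sum>m\<in>J. ?t k m) \<le> 0"
    using overlap_area_sum[OF I J d] by linarith
  moreover have "0 \<le> (\<Sum>k\<in>I. \<Sum>m\<in>J. ?t k m)" by (intro sum_nonneg) simp
  ultimately have "(\<Sum>k\<in>I. \<Sum>m\<in>J. ?t k m) = 0" by simp
  then have "?t k m = 0"
    using km fin by (simp add: sum_nonneg_eq_0_iff sum_nonneg)
  then have "(sqrt (real d - 1) * cmod (ip d (w k) (u m)))\<^sup>2
      = (sqrt (sqn d (w k) * sqn d (u m) - (cmod (ip d (w k) (u m)))\<^sup>2))\<^sup>2" by simp
  then have "(real d - 1) * (cmod (ip d (w k) (u m)))\<^sup>2
      = sqn d (w k) * sqn d (u m) - (cmod (ip d (w k) (u m)))\<^sup>2"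
    using d cauchy_schwarz[of d "w k" "u m"] by (simp add: power_mult_distrib)
  then show ?thesis by (simp add: algebra_simps)
qed

text \<open>The refinements are chosen after \<open>x\<close> and \<open>y\<close>, so that the two
  given range vectors are multiples of parts; the equality case for that pair of parts is the claim.
  The freedom in \<open>x\<close> and \<open>y\<close> is what later forces rank one.\<close>

lemma Upsilon_max_unbiased:
  assumes d: "1 \<le> d" and p: "1 \<le> p"
    and E: "measurement d nE E" and F: "measurement d nF F"
    and max: "Upsilon p nE E nF F = two_root p * real d * sqrt (real d - 1)"
    and a: "a \<in> {1..nE}" and b: "b \<in> {1..nF}"
  shows "real d * (cmod (ip d (mv d (entry (E a)) x) (mv d (entry (F b)) y)))\<^sup>2
    = sqn d (mv d (entry (E a)) x) * sqn d (mv d (entry (F b)) y)"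
proof -
  have "\<forall>a. a \<in> {1..nE} \<longrightarrow> (\<exists>w c. (\<forall>i<d. \<forall>j<d. E a $$ (i, j) = (\<Sum>k<Suc d. w k i * cnj (w k j))) \<and>
    (\<forall>i<d. mv d (entry (E a)) x i = complex_of_real c * w d i))"
    using pos_decomposition[OF measurementD(2)[OF E]] by blast
  then obtain w c where wc: "\<forall>a. a \<in> {1..nE} \<longrightarrow> (\<forall>i<d. \<forall>j<d. E a $$ (i, j) = (\<Sum>k<Suc d. w a k i * cnj (w a k j))) \<and>
    (\<forall>i<d. mv d (entry (E a)) x i = complex_of_real (c a) * w a d i)"
    unfolding choice_iff' by blast
  then have w: "\<And>a i j. a \<in> {1..nE} \<Longrightarrow> i < d \<Longrightarrow> j < d \<Longrightarrow> E a $$ (i, j) = (\<Sum>k<Suc d. w a k i * cnj (w a k j))"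
    and c: "\<And>i. i < d \<Longrightarrow> mv d (entry (E a)) x i = complex_of_real (c a) * w a d i"
    using a by blast+
  have "\<forall>b. b \<in> {1..nF} \<longrightarrow> (\<exists>u e. (\<forall>i<d. \<forall>j<d. F b $$ (i, j) = (\<Sum>k<Suc d. u k i * cnj (u k j))) \<and>
    (\<forall>i<d. mv d (entry (F b)) y i = complex_of_real e * u d i))"
    using pos_decomposition[OF measurementD(2)[OF F]] by blast
  then obtain u e where ue: "\<forall>b. b \<in> {1..nF} \<longrightarrow> (\<forall>i<d. \<forall>j<d. F b $$ (i, j) = (\<Sum>k<Suc d. u b k i * cnj (u b k j))) \<and>
    (\<forall>i<d. mv d (entry (F b)) y i = complex_of_real (e b) * u b d i)"
    unfolding choice_iff' by blast
  then have u: "\<And>b i j. b \<in> {1..nF} \<Longrightarrow> i < d \<Longrightarrow> j < d \<Longrightarrow> F b $$ (i, j) = (\<Sum>k<Suc d. u b k i * cnj (u b k j))"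
    and e: "\<And>i. i < d \<Longrightarrow> mv d (entry (F b)) y i = complex_of_real (e b) * u b d i"
    using b by blast+
  \<comment> \<open>Indices are pairs of an outcome and a part, so each measurement becomes one
    resolution of the identity by vectors.\<close>
  define I J where "I = {1..nE} \<times> {..<Suc d}" and "J = {1..nF} \<times> {..<Suc d}"
  define W U where "W = (\<lambda>(a, k). w a k)" and "U = (\<lambda>(b, m). u b m)"
  have tr: "0 < two_root p" by (simp add: two_root_def)
  have "Upsilon p nE E nF F \<le> (\<Sum>a\<in>{1..nE}. \<Sum>b\<in>{1..nF}. two_root p * (\<Sum>k<Suc d. \<Sum>m<Suc d. overlap_area d (w a k) (u b m)))"
    unfolding Upsilon_def
    by (intro sum_mono commutator_schatten_norm_le[OF d p] measurementD(1)[OF E] measurementD(1)[OF F] w u) auto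
  also have "\<dots> = two_root p * (\<Sum>a\<in>{1..nE}. \<Sum>k<Suc d. \<Sum>b\<in>{1..nF}. \<Sum>m<Suc d. overlap_area d (w a k) (u b m))"
    unfolding sum_distrib_left[symmetric]
    by (intro arg_cong[of _ _ "\<lambda>x. two_root p * x"] sum.cong refl sum.swap)
  also have "(\<Sum>a\<in>{1..nE}. \<Sum>k<Suc d. \<Sum>b\<in>{1..nF}. \<Sum>m<Suc d. overlap_area d (w a k) (u b m))
      = (\<Sum>k\<in>I. \<Sum>m\<in>J. overlap_area d (W k) (U m))"
    unfolding I_def J_def W_def U_def sum.cartesian_product' prod.case ..
  finally have "two_root p * (real d * sqrt (real d - 1))
      \<le> two_root p * (\<Sum>k\<in>I. \<Sum>m\<in>J. overlap_area d (W k) (U m))"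
    unfolding max by (simp only: mult.assoc)
  then have ge: "real d * sqrt (real d - 1) \<le> (\<Sum>k\<in>I. \<Sum>m\<in>J. overlap_area d (W k) (U m))"
    using tr by (simp only: mult_le_cancel_left_pos)
  have compl_W: "(\<Sum>k\<in>I. W k i * cnj (W k j)) = (if i = j then 1 else 0)" if "i < d" "j < d" for i j
  proof -
    have "(\<Sum>k\<in>I. W k i * cnj (W k j)) = (\<Sum>a\<in>{1..nE}. \<Sum>k<Suc d. w a k i * cnj (w a k j))"
      unfolding I_def W_def sum.cartesian_product' prod.case ..
    also have "\<dots> = (\<Sum>a\<in>{1..nE}. E a $$ (i, j))" using that w by (intro sum.cong) auto
    finally show ?thesis using measurementD(4)[OF E that] by simp
  qed
  have compl_U: "(\<Sum>k\<in>J. U k i * cnj (U k j)) = (if i = j then 1 else 0)" if "i < d" "j < d" for i j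
  proof -
    have "(\<Sum>k\<in>J. U k i * cnj (U k j)) = (\<Sum>b\<in>{1..nF}. \<Sum>k<Suc d. u b k i * cnj (u b k j))"
      unfolding J_def U_def sum.cartesian_product' prod.case ..
    also have "\<dots> = (\<Sum>b\<in>{1..nF}. F b $$ (i, j))" using that u by (intro sum.cong) auto
    finally show ?thesis using measurementD(4)[OF F that] by simp
  qed
  have "real d * (cmod (ip d (W (a, d)) (U (b, d))))\<^sup>2 = sqn d (W (a, d)) * sqn d (U (b, d))"
    by (rule overlap_area_sum_max[OF compl_W compl_U d _ _ ge]) (use a b in \<open>auto simp: I_def J_def\<close>)
  then have key: "real d * (cmod (ip d (w a d) (u b d)))\<^sup>2 = sqn d (w a d) * sqn d (u b d)"
    by (simp add: W_def U_def)
  have "ip d (mv d (entry (E a)) x) (mv d (entry (F b)) y)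
      = ip d (\<lambda>i. of_real (c a) * w a d i) (\<lambda>i. of_real (e b) * u b d i)"
    using c e by (intro ip_cong) auto
  moreover have "sqn d (mv d (entry (E a)) x) = (c a)\<^sup>2 * sqn d (w a d)"
    using c sqn_scale[of d "of_real (c a)" "w a d"] by (simp add: sqn_def)
  moreover have "sqn d (mv d (entry (F b)) y) = (e b)\<^sup>2 * sqn d (u b d)"
    using e sqn_scale[of d "of_real (e b)" "u b d"] by (simp add: sqn_def)
  ultimately show ?thesis
    using key by (simp add: ip_scale_left ip_scale_right norm_mult power_mult_distrib mult.left_commute)
qed

section \<open>The upper bound on the robustness\<close>

text \<open>The inner product with \<open>u\<close> is a linear functional on the range of
  \<open>A\<close>; the hypothesis makes its kernel trivial, so the range is
  one-dimensional.\<close>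

lemma pos_rank_one:
  assumes A: "pos d A" and D: "0 < D" and u: "sqn d u \<noteq> 0"
    and unbiased: "\<And>x. D * (cmod (ip d (mv d A x) u))\<^sup>2 = sqn d (mv d A x) * sqn d u"
    and nz: "\<exists>i<d. \<exists>j<d. A i j \<noteq> 0"
  obtains \<alpha> :: real and e where "0 < \<alpha>" and "sqn d e = 1"
    and "\<And>i j. i < d \<Longrightarrow> j < d \<Longrightarrow> A i j = of_real \<alpha> * (e i * cnj (e j))"
proof -
  obtain i0 j0 where "i0 < d" "j0 < d" "A i0 j0 \<noteq> 0" using nz by blast
  then obtain x where x: "sform d A x x \<noteq> 0"
    using kernel_eqI[of d A "\<lambda>i j. 0" i0 j0] by (auto simp: sform_entries)
  define c where "c = Re (sform d A x x)"
  have c: "sform d A x x = of_real c" unfolding c_def by (rule pos_sform_self[OF A])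
  have c0: "0 < c" using x posD(1)[OF A, of x] unfolding c_def[symmetric] c by auto
  define w where "w = mv d A x"
  have wy: "ip d w y = sform d A x y" for y by (simp add: w_def sform_def)
  have w0: "sqn d w \<noteq> 0"
  proof
    assume "sqn d w = 0"
    then have "ip d w x = 0" by (simp add: sqn_eq_0_iff ip_def)
    then show False using x wy by simp
  qed
  have wu: "ip d w u \<noteq> 0"
    using unbiased[of x] w0 u unfolding w_def by auto
  have parallel: "mv d A y i = cnj (ip d w y) / of_real c * w i" if "i < d" for y i
  proof -
    \<comment> \<open>The combination of \<open>y\<close> and \<open>x\<close> whose image under
      \<open>A\<close> is orthogonal to \<open>u\<close>; that image must vanish, which makes
      \<open>A y\<close> parallel to \<open>w\<close>.\<close>
    define z where "z = (\<lambda>i. ip d w u * y i + (- ip d (mv d A y) u) * x i)"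
    have Az: "mv d A z = (\<lambda>i. ip d w u * mv d A y i + (- ip d (mv d A y) u) * w i)"
      unfolding z_def mv_add mv_scale w_def ..
    have "ip d (mv d A z) u = 0"
      unfolding Az ip_add_left ip_scale_left by (simp add: mult.commute)
    then have "sqn d (mv d A z) = 0" using unbiased[of z] u by simp
    then have *: "ip d w u * mv d A y i = ip d (mv d A y) u * w i" if "i < d" for i
      using that unfolding sqn_eq_0_iff Az by simp
    define \<gamma> where "\<gamma> = ip d (mv d A y) u / ip d w u"
    have g: "mv d A y i = \<gamma> * w i" if "i < d" for i
      using *[OF that] wu by (simp add: \<gamma>_def field_simps)
    \<comment> \<open>Pairing with \<open>x\<close> determines the factor without reference to
      \<open>u\<close>; for \<open>y\<close> a basis vector it yields the entries of
      \<open>A\<close> as those of w w^* divided by \<open>c\<close>.\<close>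
    have "sform d A y x = \<gamma> * ip d w x"
      unfolding sform_def ip_scale_left[symmetric] by (rule ip_cong) (simp_all add: g)
    then have "\<gamma> = cnj (ip d w y) / of_real c"
      using pos_commute[OF A, of y x] c0 by (simp add: wy c)
    then show ?thesis using g that by simp
  qed
  define \<alpha> where "\<alpha> = sqn d w / c"
  have sw: "0 < sqn d w" using w0 sqn_nonneg[of d w] by simp
  show thesis
  proof (rule that[of \<alpha> "\<lambda>i. of_real (1 / sqrt (sqn d w)) * w i"])
    show "0 < \<alpha>" using sw c0 by (simp add: \<alpha>_def)
    show "sqn d (\<lambda>i. of_real (1 / sqrt (sqn d w)) * w i) = 1"
      unfolding sqn_scale using sw by (simp add: norm_divide power_divide)
    show "A i j = of_real \<alpha> * (of_real (1 / sqrt (sqn d w)) * w i * cnj (of_real (1 / sqrt (sqn d w)) * w j))"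
      if "i < d" "j < d" for i j
    proof -
      have "A i j = cnj (w j) * w i / of_real c"
        using parallel[OF that(1), of "delta j"] that(2) by (simp add: mv_delta ip_delta)
      moreover have "complex_of_real (sqrt (sqn d w)) * of_real (sqrt (sqn d w)) = of_real (sqn d w)"
        using sw by (simp flip: of_real_mult)
      ultimately show ?thesis using sw c0 by (simp add: \<alpha>_def field_simps)
    qed
  qed
qed

text \<open>The largest eigenvalue of the sum of the two projections, for distinct as well as
  parallel directions, is \<open>1 + cmod (ip d w u)\<close>.\<close>

lemma two_unit_vectors_bessel:
  assumes w: "sqn d w = 1" and u: "sqn d u = 1"
  shows "(cmod (ip d g w))\<^sup>2 + (cmod (ip d g u))\<^sup>2 \<le> (1 + cmod (ip d w u)) * sqn d g"
proof -
  define a b t where "a = ip d g w" and "b = ip d g u" and "t = cmod (ip d w u)"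
  define N where "N = (cmod a)\<^sup>2 + (cmod b)\<^sup>2"
  \<comment> \<open>The image of \<open>g\<close> under the sum of the two projections: its inner
    product with \<open>g\<close> is \<open>N\<close>, and its squared norm is at most
    \<open>(1 + t) * N\<close>.\<close>
  define h where "h = (\<lambda>i. a * w i + b * u i)"
  define z where "z = a * cnj b * ip d w u"
  have N0: "0 \<le> N" by (simp add: N_def)
  have "ip d g h = of_real N"
    unfolding h_def ip_add_right ip_scale_right a_def[symmetric] b_def[symmetric] N_def
    by (simp add: complex_norm_square mult.commute del: of_real_power)
  then have 1: "N\<^sup>2 \<le> sqn d g * sqn d h"
    using cauchy_schwarz[of d g h] by simp
  have "complex_of_real (sqn d h) = of_real ((cmod a)\<^sup>2) + of_real ((cmod b)\<^sup>2)
      + (z + cnj z)"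
    unfolding z_def ip_self[symmetric] h_def ip_add_right ip_scale_right ip_add_left ip_scale_left
    by (simp add: ip_self w u complex_norm_square ip_commute[of d u w] algebra_simps del: of_real_power)
  then have "sqn d h = N + 2 * Re z"
    by (simp add: N_def complex_eq_iff)
  also have "Re z \<le> cmod a * cmod b * t"
    using complex_Re_le_cmod[of z] by (simp add: z_def norm_mult t_def)
  also have "cmod a * cmod b * t \<le> N / 2 * t"
    using sum_squares_bound[of "cmod a" "cmod b"]
    by (intro mult_right_mono) (simp_all add: N_def t_def)
  finally have "sqn d h \<le> (1 + t) * N" by (simp add: algebra_simps)
  then have "sqn d g * sqn d h \<le> sqn d g * ((1 + t) * N)"
    by (intro mult_left_mono sqn_nonneg)
  then have 2: "N * N \<le> ((1 + t) * sqn d g) * N"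
    using 1 by (simp add: power2_eq_square mult_ac)
  have "N \<le> (1 + t) * sqn d g"
  proof (cases "N = 0")
    case True
    then show ?thesis using sqn_nonneg[of d g] by (simp add: t_def)
  next
    case False
    then show ?thesis using 2 N0 by simp
  qed
  then show ?thesis by (simp add: N_def a_def b_def t_def)
qed

text \<open>A trace against a positive operator is at most the norm times the trace. Decomposing
  \<open>G\<close> into vectors reduces this to the bound for a single vector.\<close>

lemma pos_two_unit_vectors_le_trace:
  assumes G: "pos d G" and w: "sqn d w = 1" and u: "sqn d u = 1"
  shows "Re (sform d G w w) + Re (sform d G u u) \<le> (1 + cmod (ip d w u)) * (\<Sum>i<d. Re (G i i))"
proof -
  obtain g where g: "\<And>i j. i < d \<Longrightarrow> j < d \<Longrightarrow> G i j = (\<Sum>k<d. g k i * cnj (g k j))"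
    using pos_cholesky[OF G] by blast
  have form: "Re (sform d G x x) = (\<Sum>k<d. (cmod (ip d (g k) x))\<^sup>2)" for x
  proof -
    have "sform d G x x = sform d (\<lambda>i j. \<Sum>k<d. g k i * cnj (g k j)) x x"
      by (rule sform_cong) (simp_all add: g)
    also have "\<dots> = (\<Sum>k<d. of_real ((cmod (ip d (g k) x))\<^sup>2))"
      unfolding sform_sum_kernel sform_rank_one ip_commute[of d x] complex_norm_square
      by (simp only: mult.commute)
    finally show ?thesis by (simp only: Re_sum Re_complex_of_real)
  qed
  have "(\<Sum>i<d. Re (G i i)) = (\<Sum>i<d. \<Sum>k<d. (cmod (g k i))\<^sup>2)"
    by (intro sum.cong refl) (simp add: g mult_cnj_of_real del: of_real_power)
  also have "\<dots> = (\<Sum>k<d. sqn d (g k))" unfolding sqn_def by (rule sum.swap)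
  finally have tr: "(\<Sum>i<d. Re (G i i)) = (\<Sum>k<d. sqn d (g k))" .
  show ?thesis
    unfolding form tr sum.distrib[symmetric] sum_distrib_left
    by (intro sum_mono two_unit_vectors_bessel[OF w u])
qed

lemma robustness_feasible_iff:
  assumes "measurement d nE E" and "measurement d nF F"
  shows "robustness_feasible d nE E nF F \<eta> G \<longleftrightarrow>
    (\<forall>a\<in>{1..nE}. \<forall>b\<in>{1..nF}. G a b \<in> carrier_mat d d \<and> pos d (entry (G a b))) \<and>
    (\<forall>a\<in>{1..nE}. pos d (\<lambda>i j. (\<Sum>b\<in>{1..nF}. G a b $$ (i, j)) - of_real \<eta> * E a $$ (i, j))) \<and>
    (\<forall>b\<in>{1..nF}. pos d (\<lambda>i j. (\<Sum>a\<in>{1..nE}. G a b $$ (i, j)) - of_real \<eta> * F b $$ (i, j))) \<and>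
    (\<forall>i<d. \<forall>j<d. (\<Sum>a\<in>{1..nE}. \<Sum>b\<in>{1..nF}. G a b $$ (i, j)) = (if i = j then 1 else 0))"
  unfolding robustness_feasible_def mat_sum_eq_one_iff psd_iff sum.cartesian_product' prod.case
  by (intro conj_cong ball_cong refl loewner_le_iff measurementD(1)[OF assms(1)] measurementD(1)[OF assms(2)])

text \<open>Weak duality: testing the constraints at \<open>e a\<close> and \<open>f b\<close> and
  summing gives \<open>2 * \<eta> * d\<close> on one side, and on the other the traces of
  \<open>G a b\<close> against sums of two projections, at most \<open>(1 + t) * d\<close> in
  total.\<close>

lemma feasible_le:
  assumes feas: "robustness_feasible d nE E nF F \<eta> G"
    and mE: "measurement d nE E" and mF: "measurement d nF F" and d: "1 \<le> d"
    and E: "\<And>a i j. a \<in> {1..nE} \<Longrightarrow> i < d \<Longrightarrow> j < d \<Longrightarrow> E a $$ (i, j) = complex_of_real (\<alpha> a) * (e a i * cnj (e a j))"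
    and F: "\<And>b i j. b \<in> {1..nF} \<Longrightarrow> i < d \<Longrightarrow> j < d \<Longrightarrow> F b $$ (i, j) = complex_of_real (\<beta> b) * (f b i * cnj (f b j))"
    and e: "\<And>a. a \<in> {1..nE} \<Longrightarrow> sqn d (e a) = 1" and f: "\<And>b. b \<in> {1..nF} \<Longrightarrow> sqn d (f b) = 1"
    and ef: "\<And>a b. a \<in> {1..nE} \<Longrightarrow> b \<in> {1..nF} \<Longrightarrow> cmod (ip d (e a) (f b)) \<le> t"
  shows "\<eta> \<le> (1 + t) / 2"
proof -
  note fe = feas[unfolded robustness_feasible_iff[OF mE mF]]
  note G_pos = fe[THEN conjunct1, THEN bspec, THEN bspec, THEN conjunct2]
    and G_ge_E = fe[THEN conjunct2, THEN conjunct1, THEN bspec]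
    and G_ge_F = fe[THEN conjunct2, THEN conjunct2, THEN conjunct1, THEN bspec]
    and G_sum = fe[THEN conjunct2, THEN conjunct2, THEN conjunct2, rule_format]
  \<comment> \<open>Kept generic in the measurement and in the family \<open>H\<close>, so that it
    applies to both marginals. The weights of the rank-one effects sum to the trace \<open>d\<close>
    of the identity.\<close>
  have half: "\<eta> * real d \<le> (\<Sum>a\<in>I. \<Sum>b\<in>J. Re (sform d (entry (H a b)) (x a) (x a)))"
    if M: "\<And>i j. i < d \<Longrightarrow> j < d \<Longrightarrow> (\<Sum>a\<in>I. M a $$ (i, j)) = (if i = j then 1 else 0)"
      and Mx: "\<And>a i j. a \<in> I \<Longrightarrow> i < d \<Longrightarrow> j < d \<Longrightarrow> M a $$ (i, j) = complex_of_real (m a) * (x a i * cnj (x a j))"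
      and x: "\<And>a. a \<in> I \<Longrightarrow> sqn d (x a) = 1"
      and ge: "\<And>a. a \<in> I \<Longrightarrow> pos d (\<lambda>i j. (\<Sum>b\<in>J. H a b $$ (i, j)) - of_real \<eta> * M a $$ (i, j))"
    for I J :: "nat set" and M :: "nat \<Rightarrow> complex mat" and H and m and x
  proof -
    have "complex_of_real (\<Sum>a\<in>I. m a) = (\<Sum>a\<in>I. of_real (m a) * ip d (x a) (x a))"
      by (simp add: ip_self x)
    also have "\<dots> = (\<Sum>a\<in>I. \<Sum>i<d. M a $$ (i, i))"
      by (intro sum.cong refl) (simp add: ip_def sum_distrib_left Mx)
    also have "\<dots> = (\<Sum>i<d. \<Sum>a\<in>I. M a $$ (i, i))" by (rule sum.swap)
    also have "\<dots> = of_real (real d)" by (simp add: M)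
    finally have m: "(\<Sum>a\<in>I. m a) = real d" by (simp only: of_real_eq_iff)
    have "\<eta> * m a \<le> (\<Sum>b\<in>J. Re (sform d (entry (H a b)) (x a) (x a)))" if a: "a \<in> I" for a
    proof -
      have "sform d (entry (M a)) (x a) (x a) = sform d (\<lambda>i j. of_real (m a) * (x a i * cnj (x a j))) (x a) (x a)"
        by (rule sform_cong) (simp_all add: Mx a)
      also have "\<dots> = of_real (m a)"
        unfolding sform_scale_kernel sform_rank_one by (simp add: ip_self x a)
      finally show ?thesis
        using posD(1)[OF ge[OF a], of "x a"]
        by (simp add: sform_diff_kernel sform_scale_kernel sform_sum_kernel)
    qed
    then show ?thesis unfolding m[symmetric] sum_distrib_left by (rule sum_mono)
  qed
  have "\<eta> * real d \<le> (\<Sum>a\<in>{1..nE}. \<Sum>b\<in>{1..nF}. Re (sform d (entry (G a b)) (e a) (e a)))"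
    by (rule half[where M=E and m=\<alpha>, OF measurementD(4)[OF mE] E e G_ge_E])
  moreover have "\<eta> * real d \<le> (\<Sum>b\<in>{1..nF}. \<Sum>a\<in>{1..nE}. Re (sform d (entry (G a b)) (f b) (f b)))"
    by (rule half[where M=F and m=\<beta>, OF measurementD(4)[OF mF] F f G_ge_F])
  moreover have "(\<Sum>b\<in>{1..nF}. \<Sum>a\<in>{1..nE}. Re (sform d (entry (G a b)) (f b) (f b)))
      = (\<Sum>a\<in>{1..nE}. \<Sum>b\<in>{1..nF}. Re (sform d (entry (G a b)) (f b) (f b)))"
    by (rule sum.swap)
  ultimately have "2 * \<eta> * real d \<le> (\<Sum>a\<in>{1..nE}. \<Sum>b\<in>{1..nF}.
      Re (sform d (entry (G a b)) (e a) (e a)) + Re (sform d (entry (G a b)) (f b) (f b)))"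
    by (simp add: sum.distrib)
  also have "\<dots> \<le> (\<Sum>a\<in>{1..nE}. \<Sum>b\<in>{1..nF}. (1 + t) * (\<Sum>i<d. Re (G a b $$ (i, i))))"
  proof (intro sum_mono)
    fix a b assume ab: "a \<in> {1..nE}" "b \<in> {1..nF}"
    have pos: "pos d (entry (G a b))" using ab by (rule G_pos)
    have "0 \<le> Re (G a b $$ (i, i))" if "i < d" for i
      using posD(1)[OF pos, of "delta i"] that by (simp add: sform_delta)
    then have "0 \<le> (\<Sum>i<d. Re (G a b $$ (i, i)))" by (intro sum_nonneg) simp
    then have "(1 + cmod (ip d (e a) (f b))) * (\<Sum>i<d. Re (G a b $$ (i, i)))
        \<le> (1 + t) * (\<Sum>i<d. Re (G a b $$ (i, i)))"
      using ef[OF ab] by (intro mult_right_mono) auto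
    then show "Re (sform d (entry (G a b)) (e a) (e a)) + Re (sform d (entry (G a b)) (f b) (f b))
        \<le> (1 + t) * (\<Sum>i<d. Re (G a b $$ (i, i)))"
      using pos_two_unit_vectors_le_trace[OF pos e[OF ab(1)] f[OF ab(2)]] by linarith
  qed
  also have "\<dots> = (1 + t) * (\<Sum>a\<in>{1..nE}. \<Sum>b\<in>{1..nF}. \<Sum>i<d. Re (G a b $$ (i, i)))"
    by (simp only: sum_distrib_left)
  also have "(\<Sum>a\<in>{1..nE}. \<Sum>b\<in>{1..nF}. \<Sum>i<d. Re (G a b $$ (i, i)))
      = (\<Sum>i<d. Re (\<Sum>a\<in>{1..nE}. \<Sum>b\<in>{1..nF}. G a b $$ (i, i)))"
    unfolding Re_sum by (subst sum.swap[of _ _ "{..<d}"], intro sum.cong refl sum.swap)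
  also have "\<dots> = (\<Sum>i<d. Re 1)"
    by (intro sum.cong refl arg_cong[of _ _ Re]) (simp only: G_sum lessThan_iff simp_thms if_True)
  also have "\<dots> = real d" by simp
  finally show ?thesis using d by simp
qed

lemma Upsilon_max_feasible_le:
  assumes d: "1 \<le> d" and p: "1 \<le> p"
    and E: "measurement d nE E" and F: "measurement d nF F"
    and max: "Upsilon p nE E nF F = two_root p * real d * sqrt (real d - 1)"
    and feas: "robustness_feasible d nE E nF F \<eta> G"
  shows "\<eta> \<le> 1 / 2 * (1 + 1 / sqrt (real d))"
proof -
  note unb = Upsilon_max_unbiased[OF d p E F max]
  have nz: "\<exists>i<d. \<exists>j<d. X $$ (i, j) \<noteq> 0" if "X \<in> carrier_mat d d" "X \<noteq> 0\<^sub>m d d" for X :: "complex mat"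
    using that by (auto simp: mat_eq_iff)
  have range: "\<exists>u. sqn d (mv d (entry X) u) \<noteq> 0" if "X \<in> carrier_mat d d" "X \<noteq> 0\<^sub>m d d" for X
  proof -
    from nz[OF that] obtain i j where ij: "i < d" "j < d" "X $$ (i, j) \<noteq> 0" by blast
    then have "sqn d (mv d (entry X) (delta j)) \<noteq> 0"
      by (auto simp: sqn_eq_0_iff mv_delta)
    then show ?thesis by blast
  qed
  have nonempty: "\<exists>a. a \<in> {1..n}" if "measurement d n X" for n X
    using measurementD(4)[OF that, of 0 0] d by (cases n) auto
  obtain a0 b0 where a0: "a0 \<in> {1..nE}" and b0: "b0 \<in> {1..nF}"
    using nonempty[OF E] nonempty[OF F] by blast
  \<comment> \<open>One nonzero range vector on each side suffices: it plays the role of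
    \<open>u\<close> for all effects of the other measurement.\<close>
  obtain x0 y0 where x0: "sqn d (mv d (entry (E a0)) x0) \<noteq> 0" and y0: "sqn d (mv d (entry (F b0)) y0) \<noteq> 0"
    using range measurementD(1,3)[OF E a0] measurementD(1,3)[OF F b0] by blast
  have "\<forall>a. a \<in> {1..nE} \<longrightarrow> (\<exists>\<alpha> e. 0 < \<alpha> \<and> sqn d e = 1 \<and> (\<forall>i<d. \<forall>j<d. E a $$ (i, j) = complex_of_real \<alpha> * (e i * cnj (e j))))"
  proof (intro allI impI)
    fix a assume a: "a \<in> {1..nE}"
    show "\<exists>\<alpha> e. 0 < \<alpha> \<and> sqn d e = 1 \<and> (\<forall>i<d. \<forall>j<d. E a $$ (i, j) = complex_of_real \<alpha> * (e i * cnj (e j)))"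
      by (rule pos_rank_one[of d "entry (E a)" "real d", OF measurementD(2)[OF E a] _ y0 unb[OF a b0]
            nz[OF measurementD(1,3)[OF E a]]]) (use d in auto)
  qed
  then obtain \<alpha> e where Ee: "\<And>a. a \<in> {1..nE} \<Longrightarrow> 0 < \<alpha> a \<and> sqn d (e a) = 1 \<and>
      (\<forall>i<d. \<forall>j<d. E a $$ (i, j) = complex_of_real (\<alpha> a) * (e a i * cnj (e a j)))"
    unfolding choice_iff' by blast
  have "\<forall>b. b \<in> {1..nF} \<longrightarrow> (\<exists>\<beta> f. 0 < \<beta> \<and> sqn d f = 1 \<and> (\<forall>i<d. \<forall>j<d. F b $$ (i, j) = complex_of_real \<beta> * (f i * cnj (f j))))"
  proof (intro allI impI)
    fix b assume b: "b \<in> {1..nF}"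
    have unb': "real d * (cmod (ip d (mv d (entry (F b)) y) (mv d (entry (E a0)) x0)))\<^sup>2
        = sqn d (mv d (entry (F b)) y) * sqn d (mv d (entry (E a0)) x0)" for y
      using unb[OF a0 b, of x0 y] by (simp add: cmod_ip_commute mult.commute)
    show "\<exists>\<beta> f. 0 < \<beta> \<and> sqn d f = 1 \<and> (\<forall>i<d. \<forall>j<d. F b $$ (i, j) = complex_of_real \<beta> * (f i * cnj (f j)))"
      by (rule pos_rank_one[of d "entry (F b)" "real d", OF measurementD(2)[OF F b] _ x0 unb'
            nz[OF measurementD(1,3)[OF F b]]]) (use d in auto)
  qed
  then obtain \<beta> f where Ff: "\<And>b. b \<in> {1..nF} \<Longrightarrow> 0 < \<beta> b \<and> sqn d (f b) = 1 \<and>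
      (\<forall>i<d. \<forall>j<d. F b $$ (i, j) = complex_of_real (\<beta> b) * (f b i * cnj (f b j)))"
    unfolding choice_iff' by blast
  \<comment> \<open>The unit vectors are eigenvectors of their effects, so evaluating the overlap
    identity at them gives the squared overlap \<open>1 / d\<close>.\<close>
  have eigen: "mv d (entry X) x i = of_real r * x i"
    if "\<forall>i<d. \<forall>j<d. X $$ (i, j) = complex_of_real r * (x i * cnj (x j))" "sqn d x = 1" "i < d" for X r x i
  proof -
    have "mv d (entry X) x i = of_real r * x i * ip d x x"
      using that by (simp add: mv_def ip_def sum_distrib_left mult_ac)
    then show ?thesis by (simp add: ip_self that)
  qed
  have "cmod (ip d (e a) (f b)) \<le> 1 / sqrt (real d)" if a: "a \<in> {1..nE}" and b: "b \<in> {1..nF}" for a b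
  proof -
    have e: "mv d (entry (E a)) (e a) i = of_real (\<alpha> a) * e a i"
      and f: "mv d (entry (F b)) (f b) i = of_real (\<beta> b) * f b i" if "i < d" for i
      using eigen Ee[OF a] Ff[OF b] that by blast+
    have "ip d (mv d (entry (E a)) (e a)) (mv d (entry (F b)) (f b)) = of_real (\<alpha> a) * of_real (\<beta> b) * ip d (e a) (f b)"
      using ip_cong[of d "mv d (entry (E a)) (e a)" "\<lambda>i. of_real (\<alpha> a) * e a i"
          "mv d (entry (F b)) (f b)" "\<lambda>i. of_real (\<beta> b) * f b i"] e f
      by (simp add: ip_scale_left ip_scale_right)
    moreover have "sqn d (mv d (entry (E a)) (e a)) = (\<alpha> a)\<^sup>2"
      using e Ee[OF a] sqn_scale[of d "of_real (\<alpha> a)" "e a"] by (simp add: sqn_def)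
    moreover have "sqn d (mv d (entry (F b)) (f b)) = (\<beta> b)\<^sup>2"
      using f Ff[OF b] sqn_scale[of d "of_real (\<beta> b)" "f b"] by (simp add: sqn_def)
    ultimately have "real d * ((\<alpha> a)\<^sup>2 * (\<beta> b)\<^sup>2 * (cmod (ip d (e a) (f b)))\<^sup>2) = (\<alpha> a)\<^sup>2 * (\<beta> b)\<^sup>2"
      using unb[OF a b, of "e a" "f b"] by (simp add: norm_mult power_mult_distrib)
    then have sq: "(cmod (ip d (e a) (f b)))\<^sup>2 = 1 / real d"
      using Ee[OF a] Ff[OF b] d by (simp add: field_simps)
    show ?thesis using real_sqrt_unique[OF sq norm_ge_zero] by (simp add: real_sqrt_divide)
  qed
  then have "\<eta> \<le> (1 + 1 / sqrt (real d)) / 2"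
    by (intro feasible_le[where \<alpha>=\<alpha> and e=e and \<beta>=\<beta> and f=f, OF feas E F d]) (use Ee Ff in blast)+
  then show ?thesis by simp
qed

section \<open>The lower bound on the robustness\<close>

text \<open>The kernel on the left is that of \<open>A\<close> conjugated by \<open>T\<close>, the
  adjoint of \<open>T\<close> standing on the left, written through its values on basis
  vectors.\<close>

lemma sform_conjugated_kernel:
  "sform d (\<lambda>i j. sform d A (mv d T (delta j)) (mv d T (delta i))) x y = sform d A (mv d T x) (mv d T y)"
proof -
  have T: "mv d T z = (\<lambda>i. \<Sum>j<d. z j * mv d T (delta j) i)" for z
    by (rule ext) (simp add: mv_delta, simp add: mv_def mult.commute)
  define B where "B = (\<lambda>i j. sform d A (mv d T (delta j)) (mv d T (delta i)))"
  have "sform d A (mv d T x) (mv d T y) = (\<Sum>j<d. \<Sum>i<d. B i j * x j * cnj (y i))"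
    unfolding T[of x] T[of y] sform_sum_left sform_sum_right sform_scale_left sform_scale_right B_def
      sum_distrib_left by (simp only: mult_ac)
  also have "\<dots> = sform d B x y"
    unfolding sform_entries[of d B] by (rule sum.swap)
  finally show ?thesis by (simp only: B_def)
qed

lemma unit_rescaling:
  assumes "1 \<le> d"
  shows "\<exists>(\<alpha> :: real) e. 0 \<le> \<alpha> \<and> sqn d e = 1 \<and> (\<forall>i<d. \<forall>j<d. w i * cnj (w j) = of_real \<alpha> * (e i * cnj (e j)))"
proof (cases "sqn d w = 0")
  case True
  \<comment> \<open>A zero vector receives weight 0 and an arbitrary unit vector as its
    direction.\<close>
  have "sqn d (delta 0) = 1"
    using assms ip_self[of d "delta 0"] ip_delta[of 0 d "delta 0"] by (simp add: delta_def)
  then show ?thesis using True by (intro exI[of _ 0] exI[of _ "delta 0"]) (simp add: sqn_eq_0_iff)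
next
  case False
  then have w: "0 < sqn d w" using sqn_nonneg[of d w] by simp
  let ?e = "\<lambda>i. of_real (1 / sqrt (sqn d w)) * w i"
  have "sqn d ?e = 1" unfolding sqn_scale using w by (simp add: norm_divide power_divide)
  moreover have "w i * cnj (w j) = of_real (sqn d w) * (?e i * cnj (?e j))" for i j
  proof -
    have "complex_of_real (sqrt (sqn d w)) * of_real (sqrt (sqn d w)) = of_real (sqn d w)"
      using w by (simp flip: of_real_mult)
    then show ?thesis using w by (simp add: field_simps)
  qed
  ultimately show ?thesis using w by (intro exI[of _ "sqn d w"] exI[of _ ?e]) simp
qed

lemma pos_unit_decomposition:
  assumes "pos d A" and "1 \<le> d"
  shows "\<exists>(\<alpha> :: nat \<Rightarrow> real) e. (\<forall>k. 0 \<le> \<alpha> k \<and> sqn d (e k) = 1) \<and>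
    (\<forall>i<d. \<forall>j<d. A i j = (\<Sum>k<d. of_real (\<alpha> k) * (e k i * cnj (e k j))))"
proof -
  obtain w where w: "\<And>i j. i < d \<Longrightarrow> j < d \<Longrightarrow> A i j = (\<Sum>k<d. w k i * cnj (w k j))"
    using pos_cholesky[OF assms(1)] by blast
  have "\<forall>k. \<exists>(\<alpha> :: real) e. 0 \<le> \<alpha> \<and> sqn d e = 1 \<and> (\<forall>i<d. \<forall>j<d. w k i * cnj (w k j) = of_real \<alpha> * (e i * cnj (e j)))"
    using unit_rescaling[OF assms(2)] by blast
  then obtain \<alpha> :: "nat \<Rightarrow> real" and e where "\<forall>k. 0 \<le> \<alpha> k \<and> sqn d (e k) = 1 \<and>
      (\<forall>i<d. \<forall>j<d. w k i * cnj (w k j) = of_real (\<alpha> k) * (e k i * cnj (e k j)))"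
    unfolding choice_iff by blast
  then show ?thesis using w by (intro exI[of _ \<alpha>] exI[of _ e]) simp
qed

lemma weighted_resolution:
  assumes e: "\<And>k. k \<in> I \<Longrightarrow> sqn d (e k) = 1"
    and complete: "\<And>i j. i < d \<Longrightarrow> j < d \<Longrightarrow> (\<Sum>k\<in>I. complex_of_real (\<alpha> k) * (e k i * cnj (e k j))) = (if i = j then 1 else 0)"
  shows weighted_resolution_vec: "i < d \<Longrightarrow> (\<Sum>k\<in>I. of_real (\<alpha> k) * (ip d x (e k) * e k i)) = x i"
    and weighted_resolution_trace: "(\<Sum>k\<in>I. \<alpha> k) = real d"
    and weighted_resolution_sqn: "(\<Sum>k\<in>I. \<alpha> k * (cmod (ip d x (e k)))\<^sup>2) = sqn d x"
proof -
  have "complex_of_real (\<Sum>k\<in>I. \<alpha> k) = (\<Sum>k\<in>I. of_real (\<alpha> k) * ip d (e k) (e k))"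
    by (simp add: ip_self e)
  also have "\<dots> = (\<Sum>k\<in>I. \<Sum>i<d. of_real (\<alpha> k) * (e k i * cnj (e k i)))"
    by (simp add: ip_def sum_distrib_left)
  also have "\<dots> = (\<Sum>i<d. \<Sum>k\<in>I. of_real (\<alpha> k) * (e k i * cnj (e k i)))" by (rule sum.swap)
  also have "\<dots> = of_real (real d)" by (simp add: complete)
  finally show "(\<Sum>k\<in>I. \<alpha> k) = real d" by (simp only: of_real_eq_iff)
  show res: "(\<Sum>k\<in>I. of_real (\<alpha> k) * (ip d x (e k) * e k i)) = x i" if "i < d" for i
  proof -
    have "(\<Sum>k\<in>I. of_real (\<alpha> k) * (ip d x (e k) * e k i))
        = (\<Sum>k\<in>I. \<Sum>j<d. x j * (of_real (\<alpha> k) * (e k i * cnj (e k j))))"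
      by (simp add: ip_def sum_distrib_left sum_distrib_right mult_ac)
    also have "\<dots> = (\<Sum>j<d. x j * (\<Sum>k\<in>I. of_real (\<alpha> k) * (e k i * cnj (e k j))))"
      unfolding sum_distrib_left by (rule sum.swap)
    also have "\<dots> = (\<Sum>j<d. if i = j then x j else 0)"
      using that complete by (intro sum.cong) auto
    finally show ?thesis using that by simp
  qed
  have "complex_of_real (\<Sum>k\<in>I. \<alpha> k * (cmod (ip d x (e k)))\<^sup>2)
      = ip d (\<lambda>i. \<Sum>k\<in>I. of_real (\<alpha> k) * (ip d x (e k) * e k i)) x"
    unfolding ip_sum_left ip_scale_left
    by (simp add: ip_commute[of d "e _" x] mult_cnj_of_real del: of_real_power)
  also have "\<dots> = ip d x x" by (rule ip_cong) (simp_all add: res)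
  finally show "(\<Sum>k\<in>I. \<alpha> k * (cmod (ip d x (e k)))\<^sup>2) = sqn d x"
    by (simp only: ip_self of_real_eq_iff)
qed

text \<open>With P t x k the vector (e_k e_k^* + t) x, the weighted sum is a quadratic polynomial in t;
  its nonnegativity at t = - 1 / d bounds the constant coefficient from below.\<close>

lemma weighted_resolution_form_ge:
  assumes F: "pos d F" and d: "1 \<le> d"
    and \<alpha>: "\<And>k. k \<in> I \<Longrightarrow> 0 \<le> \<alpha> k" and e: "\<And>k. k \<in> I \<Longrightarrow> sqn d (e k) = 1"
    and complete: "\<And>i j. i < d \<Longrightarrow> j < d \<Longrightarrow> (\<Sum>k\<in>I. complex_of_real (\<alpha> k) * (e k i * cnj (e k j))) = (if i = j then 1 else 0)"
  defines "P \<equiv> \<lambda>t x k i. ip d x (e k) * e k i + complex_of_real t * x i"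
  shows "(2 * t + 1 / real d + t\<^sup>2 * real d) * Re (sform d F x x) \<le> (\<Sum>k\<in>I. \<alpha> k * Re (sform d F (P t x k) (P t x k)))"
proof -
  note res = weighted_resolution_vec[where \<alpha>=\<alpha> and e=e, OF e complete]
    and tr = weighted_resolution_trace[where \<alpha>=\<alpha> and e=e, OF e complete]
  define p where "p = (\<lambda>k i. ip d x (e k) * e k i)"
  define S where "S = (\<Sum>k\<in>I. \<alpha> k * Re (sform d F (p k) (p k)))"
  define f where "f = Re (sform d F x x)"
  \<comment> \<open>The linear coefficient needs no estimate: the weighted vectors
    \<open>p k\<close> sum to \<open>x\<close>.\<close>
  have cross: "(\<Sum>k\<in>I. \<alpha> k * Re (sform d F (p k) x)) = f"
  proof -
    have "(\<Sum>k\<in>I. of_real (\<alpha> k) * sform d F (p k) x) = sform d F (\<lambda>i. \<Sum>k\<in>I. of_real (\<alpha> k) * p k i) x"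
      by (simp add: sform_sum_left sform_scale_left)
    also have "\<dots> = sform d F x x"
      by (rule sform_cong) (simp_all add: p_def res)
    finally have "Re (\<Sum>k\<in>I. of_real (\<alpha> k) * sform d F (p k) x) = f" by (simp add: f_def)
    then show ?thesis by simp
  qed
  have quad: "(\<Sum>k\<in>I. \<alpha> k * Re (sform d F (P t x k) (P t x k))) = S + 2 * t * f + t\<^sup>2 * real d * f" for t
  proof -
    have "Re (sform d F (P t x k) (P t x k)) = Re (sform d F (p k) (p k)) + 2 * t * Re (sform d F (p k) x) + t\<^sup>2 * f" for k
      using sform_combination[of d F "p k" "of_real t" x] pos_commute[OF F, of x "p k"]
      by (simp add: P_def p_def f_def)
    then have "(\<Sum>k\<in>I. \<alpha> k * Re (sform d F (P t x k) (P t x k)))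
        = (\<Sum>k\<in>I. \<alpha> k * Re (sform d F (p k) (p k)) + 2 * t * (\<alpha> k * Re (sform d F (p k) x)) + t\<^sup>2 * f * \<alpha> k)"
      by (simp add: algebra_simps)
    also have "\<dots> = S + 2 * t * f + t\<^sup>2 * f * real d"
      by (simp only: sum.distrib sum_distrib_left[symmetric] cross tr S_def)
    finally show ?thesis by (simp add: mult_ac)
  qed
  \<comment> \<open>The quadratic \<open>S + 2 * t * f + t\<^sup>2 * d * f\<close> takes its least
    value at this \<open>t\<close>, so the resulting bound on \<open>S\<close> is the best
    obtainable from nonnegativity.\<close>
  have "0 \<le> (\<Sum>k\<in>I. \<alpha> k * Re (sform d F (P (- 1 / real d) x k) (P (- 1 / real d) x k)))"
    using \<alpha> posD(1)[OF F] by (intro sum_nonneg mult_nonneg_nonneg)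
  then have "f / real d \<le> S"
    unfolding quad using d by (simp add: power2_eq_square field_simps)
  then show "(2 * t + 1 / real d + t\<^sup>2 * real d) * Re (sform d F x x) \<le> (\<Sum>k\<in>I. \<alpha> k * Re (sform d F (P t x k) (P t x k)))"
    unfolding quad f_def[symmetric] by (simp add: algebra_simps)
qed

lemma pos_realI:
  assumes "\<And>x. \<exists>r\<ge>0. sform d A x x = complex_of_real r"
  shows "pos d A"
  unfolding pos_def
proof
  fix x
  obtain r where "0 \<le> r" "sform d A x x = complex_of_real r" using assms by blast
  then show "0 \<le> sform d A x x" by (simp add: less_eq_complex_def)
qed

text \<open>With t in place of 1 / sqrt d in the family, the bounds for the marginals have the
  factors 1 + 2 t + t^2 for E and 2 t + 1 / d + t^2 d for F. They agree at t = 1 / sqrt d, where the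
  total is 2 + 2 t times the identity; this fixes \<open>c\<close>.\<close>

lemma feasible_exists:
  assumes d: "1 \<le> d" and mE: "measurement d nE E" and mF: "measurement d nF F"
  shows "\<exists>G. robustness_feasible d nE E nF F (1 / 2 * (1 + 1 / sqrt (real d))) G"
proof -
  define s where "s = sqrt (real d)"
  have s: "0 < s" "s * s = real d" using d by (simp_all add: s_def)
  define c where "c = 1 / (2 + 2 / s)"
  have c0: "0 < c" using s by (simp add: c_def add_pos_pos)
  have c1: "c * (2 + 2 / s) = 1" using s by (simp add: c_def add_pos_pos less_imp_neq[symmetric] field_simps)
  \<comment> \<open>With t = 1 / s this is (1 + t)^2 / (2 (1 + t)) = (1 + t) / 2.\<close>
  have c2: "c * (1 + 2 / s + 1 / real d) = 1 / 2 * (1 + 1 / s)"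
  proof -
    have "1 + 2 / s + 1 / real d = (2 + 2 / s) * (1 / 2 * (1 + 1 / s))"
      using s by (simp add: s(2)[symmetric] field_simps)
    then have "c * (1 + 2 / s + 1 / real d) = c * (2 + 2 / s) * (1 / 2 * (1 + 1 / s))"
      by (simp only: mult.assoc)
    then show ?thesis by (simp only: c1 mult_1)
  qed
  have "\<forall>a. a \<in> {1..nE} \<longrightarrow> (\<exists>(\<alpha> :: nat \<Rightarrow> real) e. (\<forall>k. 0 \<le> \<alpha> k \<and> sqn d (e k) = 1) \<and>
    (\<forall>i<d. \<forall>j<d. E a $$ (i, j) = (\<Sum>k<d. of_real (\<alpha> k) * (e k i * cnj (e k j)))))"
    using pos_unit_decomposition[OF measurementD(2)[OF mE] d] by blast
  then obtain \<alpha> :: "nat \<Rightarrow> nat \<Rightarrow> real" and e where dec: "\<forall>a. a \<in> {1..nE} \<longrightarrow> (\<forall>k. 0 \<le> \<alpha> a k \<and> sqn d (e a k) = 1) \<and>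
    (\<forall>i<d. \<forall>j<d. E a $$ (i, j) = (\<Sum>k<d. of_real (\<alpha> a k) * (e a k i * cnj (e a k j))))"
    unfolding choice_iff' by blast
  have \<alpha>: "0 \<le> \<alpha> a k" and e: "sqn d (e a k) = 1" if "a \<in> {1..nE}" for a k
    using dec that by blast+
  have Eae: "E a $$ (i, j) = (\<Sum>k<d. of_real (\<alpha> a k) * (e a k i * cnj (e a k j)))" if "a \<in> {1..nE}" "i < d" "j < d" for a i j
    using dec that by blast
  define T where "T = (\<lambda>a k i j. e a k i * cnj (e a k j) + (if i = j then of_real (1 / s) else 0))"
  define P where "P = (\<lambda>x a k i. ip d x (e a k) * e a k i + of_real (1 / s) * x i)"
  have T: "mv d (T a k) x i = P x a k i" if "i < d" for a k x i
  proof -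
    have "mv d (T a k) x i = (\<Sum>j<d. e a k i * (x j * cnj (e a k j)) + (if i = j then of_real (1 / s) * x j else 0))"
      unfolding mv_def T_def by (intro sum.cong refl) (simp add: algebra_simps)
    also have "\<dots> = P x a k i"
      using that unfolding sum.distrib sum_distrib_left[symmetric] by (simp add: P_def ip_def mult.commute)
    finally show ?thesis .
  qed
  define K where "K = (\<lambda>a b i j. \<Sum>k<d. of_real (c * \<alpha> a k) * sform d (entry (F b)) (mv d (T a k) (delta j)) (mv d (T a k) (delta i)))"
  define G where "G = (\<lambda>a b. mat d d (\<lambda>(i, j). K a b i j))"
  have K: "sform d (K a b) x x = (\<Sum>k<d. of_real (c * \<alpha> a k) * sform d (entry (F b)) (P x a k) (P x a k))" for a b x
  proof -
    have "sform d (K a b) x x = (\<Sum>k<d. of_real (c * \<alpha> a k) * sform d (entry (F b)) (mv d (T a k) x) (mv d (T a k) x))"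
      unfolding K_def sform_sum_kernel sform_scale_kernel sform_conjugated_kernel ..
    also have "\<dots> = (\<Sum>k<d. of_real (c * \<alpha> a k) * sform d (entry (F b)) (P x a k) (P x a k))"
      by (intro sum.cong refl arg_cong2[of _ _ _ _ times] sform_cong) (simp_all add: T)
    finally show ?thesis .
  qed
  have K_real: "sform d (K a b) x x = of_real (c * (\<Sum>k<d. \<alpha> a k * Re (sform d (entry (F b)) (P x a k) (P x a k))))"
    if "b \<in> {1..nF}" for a b x
  proof -
    have "sform d (K a b) x x = (\<Sum>k<d. of_real (c * \<alpha> a k) * of_real (Re (sform d (entry (F b)) (P x a k) (P x a k))))"
      unfolding K by (intro sum.cong refl arg_cong2[of _ _ _ _ times] pos_sform_self measurementD(2)[OF mF that])
    then show ?thesis by (simp add: sum_distrib_left mult.assoc)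
  qed
  have F_sum: "(\<Sum>b\<in>{1..nF}. sform d (entry (F b)) x x) = of_real (sqn d x)" for x
  proof -
    have "(\<Sum>b\<in>{1..nF}. sform d (entry (F b)) x x) = sform d (\<lambda>i j. if i = j then 1 else 0) x x"
      unfolding sform_sum_kernel[symmetric] by (rule sform_cong) (simp_all only: measurementD(4)[OF mF])
    then show ?thesis by (simp add: sform_id ip_self)
  qed
  have sqnP: "sqn d (P x a k) = (1 + 2 / s) * (cmod (ip d x (e a k)))\<^sup>2 + sqn d x / real d"
    if "a \<in> {1..nE}" for x a k
  proof -
    define u where "u = (\<lambda>i. ip d x (e a k) * e a k i)"
    have u: "ip d u u = of_real ((cmod (ip d x (e a k)))\<^sup>2)" "ip d u x = of_real ((cmod (ip d x (e a k)))\<^sup>2)"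
      "ip d x u = of_real ((cmod (ip d x (e a k)))\<^sup>2)"
      unfolding u_def ip_scale_left ip_scale_right ip_commute[of d "e a k" x] ip_self e[OF that]
      by (simp_all add: complex_norm_square mult.commute del: of_real_power)
    have t: "(cmod (complex_of_real (1 / s)))\<^sup>2 = 1 / real d"
      using s by (simp add: norm_divide power_divide power2_eq_square)
    have "ip d (P x a k) (P x a k) = of_real ((1 + 2 / s) * (cmod (ip d x (e a k)))\<^sup>2 + sqn d x / real d)"
      using sform_combination[of d "\<lambda>i j. if i = j then 1 else 0" u "of_real (1 / s)" x]
      unfolding sform_id u t ip_self[of d x] P_def u_def[symmetric]
      by (simp add: u_def algebra_simps)
    then show ?thesis by (simp only: ip_self of_real_eq_iff)
  qed
  \<comment> \<open>As F resolves the identity and (P_k + t)^2 = (1 + 2 t) P_k + t^2, the marginal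
    is \<open>c\<close> times the sum of (1 + 2 t) E_a and tr (E_a) / d, where t = 1 / s.\<close>
  have K_sum_b: "(\<Sum>b\<in>{1..nF}. sform d (K a b) x x)
      = of_real (c * ((1 + 2 / s) * (\<Sum>k<d. \<alpha> a k * (cmod (ip d x (e a k)))\<^sup>2) + sqn d x / real d * (\<Sum>k<d. \<alpha> a k)))"
    if "a \<in> {1..nE}" for a x
  proof -
    have "(\<Sum>b\<in>{1..nF}. sform d (K a b) x x)
        = (\<Sum>k<d. of_real (c * \<alpha> a k) * (\<Sum>b\<in>{1..nF}. sform d (entry (F b)) (P x a k) (P x a k)))"
      unfolding K sum_distrib_left by (rule sum.swap)
    also have "\<dots> = of_real (\<Sum>k<d. c * \<alpha> a k * ((1 + 2 / s) * (cmod (ip d x (e a k)))\<^sup>2 + sqn d x / real d))"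
      unfolding F_sum sqnP[OF that] by (simp only: of_real_mult of_real_sum)
    also have "(\<Sum>k<d. c * \<alpha> a k * ((1 + 2 / s) * (cmod (ip d x (e a k)))\<^sup>2 + sqn d x / real d))
        = c * ((1 + 2 / s) * (\<Sum>k<d. \<alpha> a k * (cmod (ip d x (e a k)))\<^sup>2) + sqn d x / real d * (\<Sum>k<d. \<alpha> a k))"
      unfolding sum_distrib_left sum.distrib[symmetric] by (intro sum.cong refl) (simp only: algebra_simps)
    finally show ?thesis .
  qed
  have G_form: "sform d (entry (G a b)) x x = sform d (K a b) x x" for a b x
    by (rule sform_cong) (simp_all add: G_def)
  have E_form: "sform d (entry (E a)) x x = of_real (\<Sum>k<d. \<alpha> a k * (cmod (ip d x (e a k)))\<^sup>2)"
    if "a \<in> {1..nE}" for a x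
  proof -
    have "sform d (entry (E a)) x x = sform d (\<lambda>i j. \<Sum>k<d. of_real (\<alpha> a k) * (e a k i * cnj (e a k j))) x x"
      by (rule sform_cong) (simp_all only: Eae[OF that])
    then show ?thesis
      by (simp add: sform_sum_kernel sform_scale_kernel sform_rank_one ip_commute[of d "e a _" x]
          mult_cnj_of_real del: of_real_power)
  qed
  define I where "I = {1..nE} \<times> {..<d}"
  define A where "A = (\<lambda>(a, k). \<alpha> a k)"
  define V where "V = (\<lambda>(a, k). e a k)"
  have complete: "(\<Sum>k\<in>I. complex_of_real (A k) * (V k i * cnj (V k j))) = (if i = j then 1 else 0)"
    if "i < d" "j < d" for i j
  proof -
    have "(\<Sum>k\<in>I. complex_of_real (A k) * (V k i * cnj (V k j))) = (\<Sum>a\<in>{1..nE}. E a $$ (i, j))"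
      unfolding I_def A_def V_def sum.cartesian_product' prod.case
      by (intro sum.cong refl) (simp only: Eae that)
    then show ?thesis by (simp only: measurementD(4)[OF mE that])
  qed
  have A: "0 \<le> A k" and V: "sqn d (V k) = 1" if "k \<in> I" for k
    using that \<alpha> e by (auto simp: I_def A_def V_def)
  note form_ge = weighted_resolution_form_ge[where I=I and \<alpha>=A and e=V, OF _ d A V complete]
  have A_sum: "(\<Sum>a\<in>{1..nE}. \<Sum>k<d. \<alpha> a k) = real d"
    using weighted_resolution_trace[where I=I and \<alpha>=A and e=V, OF V complete]
    unfolding I_def A_def sum.cartesian_product' prod.case .
  have A_ip: "(\<Sum>a\<in>{1..nE}. \<Sum>k<d. \<alpha> a k * (cmod (ip d x (e a k)))\<^sup>2) = sqn d x" for x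
    using weighted_resolution_sqn[where I=I and \<alpha>=A and e=V and x=x, OF V complete]
    unfolding I_def A_def V_def sum.cartesian_product' prod.case .
  have "pos d (entry (G a b))" if "a \<in> {1..nE}" "b \<in> {1..nF}" for a b
  proof (rule pos_realI)
    fix x
    have "0 \<le> c * (\<Sum>k<d. \<alpha> a k * Re (sform d (entry (F b)) (P x a k) (P x a k)))"
      using c0 \<alpha>[OF that(1)] posD(1)[OF measurementD(2)[OF mF that(2)]]
      by (intro mult_nonneg_nonneg sum_nonneg) auto
    then show "\<exists>r\<ge>0. sform d (entry (G a b)) x x = complex_of_real r"
      unfolding G_form K_real[OF that(2)] by blast
  qed
  moreover have "pos d (\<lambda>i j. (\<Sum>b\<in>{1..nF}. G a b $$ (i, j)) - of_real (1 / 2 * (1 + 1 / s)) * E a $$ (i, j))"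
    if a: "a \<in> {1..nE}" for a
  proof (rule pos_realI)
    fix x
    define S where "S = (\<Sum>k<d. \<alpha> a k * (cmod (ip d x (e a k)))\<^sup>2)"
    define t where "t = (\<Sum>k<d. \<alpha> a k)"
    \<comment> \<open>An effect is at most its trace, here \<open>t\<close>, times the identity;
      this converts the scalar term of the marginal into a multiple of \<open>E a\<close>.\<close>
    have "S \<le> (\<Sum>k<d. \<alpha> a k * sqn d x)"
      unfolding S_def
    proof (intro sum_mono mult_left_mono \<alpha>[OF a])
      show "(cmod (ip d x (e a k)))\<^sup>2 \<le> sqn d x" for k
        using cauchy_schwarz[of d x "e a k"] e[OF a] by simp
    qed
    then have "S \<le> t * sqn d x" by (simp only: t_def sum_distrib_right)
    then have "S / real d \<le> t * sqn d x / real d" using d by (intro divide_right_mono) auto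
    then have "(1 + 2 / s + 1 / real d) * S \<le> (1 + 2 / s) * S + sqn d x / real d * t"
      by (simp add: algebra_simps)
    then have "c * (1 + 2 / s + 1 / real d) * S \<le> c * ((1 + 2 / s) * S + sqn d x / real d * t)"
      using c0 by (simp add: mult.assoc)
    then have "0 \<le> c * ((1 + 2 / s) * S + sqn d x / real d * t) - 1 / 2 * (1 + 1 / s) * S"
      unfolding c2 by simp
    moreover have "sform d (\<lambda>i j. (\<Sum>b\<in>{1..nF}. G a b $$ (i, j)) - of_real (1 / 2 * (1 + 1 / s)) * E a $$ (i, j)) x x
        = of_real (c * ((1 + 2 / s) * S + sqn d x / real d * t) - 1 / 2 * (1 + 1 / s) * S)"
      unfolding sform_diff_kernel sform_scale_kernel sform_sum_kernel G_form K_sum_b[OF a] E_form[OF a]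
      by (simp only: S_def t_def of_real_diff of_real_mult)
    ultimately show "\<exists>r\<ge>0. sform d (\<lambda>i j. (\<Sum>b\<in>{1..nF}. G a b $$ (i, j)) - of_real (1 / 2 * (1 + 1 / s)) * E a $$ (i, j)) x x
        = complex_of_real r" by blast
  qed
  moreover have "pos d (\<lambda>i j. (\<Sum>a\<in>{1..nE}. G a b $$ (i, j)) - of_real (1 / 2 * (1 + 1 / s)) * F b $$ (i, j))"
    if b: "b \<in> {1..nF}" for b
  proof (rule pos_realI)
    fix x
    note F_pos = measurementD(2)[OF mF b]
    define f where "f = Re (sform d (entry (F b)) x x)"
    define S where "S = (\<Sum>a\<in>{1..nE}. \<Sum>k<d. \<alpha> a k * Re (sform d (entry (F b)) (P x a k) (P x a k)))"
    \<comment> \<open>At this shift the factor in \<open>form_ge\<close> becomes the same constant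
      as for the other marginal.\<close>
    have "(1 / s)\<^sup>2 * real d = 1" using s d by (simp add: power2_eq_square field_simps)
    then have "(1 + 2 / s + 1 / real d) * f \<le> S"
      using form_ge[OF F_pos, of "1 / s" x]
      unfolding I_def A_def V_def sum.cartesian_product' prod.case f_def S_def P_def by (simp add: add.commute add.left_commute)
    then have "c * (1 + 2 / s + 1 / real d) * f \<le> c * S" using c0 by (simp add: mult.assoc)
    then have "0 \<le> c * S - 1 / 2 * (1 + 1 / s) * f" unfolding c2 by simp
    moreover have "sform d (\<lambda>i j. (\<Sum>a\<in>{1..nE}. G a b $$ (i, j)) - of_real (1 / 2 * (1 + 1 / s)) * F b $$ (i, j)) x x
        = of_real (c * S - 1 / 2 * (1 + 1 / s) * f)"
      unfolding sform_diff_kernel sform_scale_kernel sform_sum_kernel G_form K_real[OF b] of_real_sum[symmetric]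
        sum_distrib_left[symmetric] S_def[symmetric]
      by (subst pos_sform_self[OF F_pos]) (simp only: f_def of_real_diff of_real_mult)
    ultimately show "\<exists>r\<ge>0. sform d (\<lambda>i j. (\<Sum>a\<in>{1..nE}. G a b $$ (i, j)) - of_real (1 / 2 * (1 + 1 / s)) * F b $$ (i, j)) x x
        = complex_of_real r" by blast
  qed
  moreover have "(\<Sum>a\<in>{1..nE}. \<Sum>b\<in>{1..nF}. G a b $$ (i, j)) = (if i = j then 1 else 0)"
    if ij: "i < d" "j < d" for i j
  proof (rule kernel_eqI[OF _ ij])
    fix x
    have "sform d (\<lambda>i j. \<Sum>a\<in>{1..nE}. \<Sum>b\<in>{1..nF}. G a b $$ (i, j)) x x
        = of_real (\<Sum>a\<in>{1..nE}. c * ((1 + 2 / s) * (\<Sum>k<d. \<alpha> a k * (cmod (ip d x (e a k)))\<^sup>2) + sqn d x / real d * (\<Sum>k<d. \<alpha> a k)))"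
      unfolding sform_sum_kernel G_form of_real_sum by (intro sum.cong refl K_sum_b)
    also have "\<dots> = of_real (c * (2 + 2 / s) * sqn d x)"
      unfolding sum_distrib_left[symmetric] sum.distrib A_sum A_ip using d by (simp add: algebra_simps)
    finally show "sform d (\<lambda>i j. \<Sum>a\<in>{1..nE}. \<Sum>b\<in>{1..nF}. G a b $$ (i, j)) x x
        = sform d (\<lambda>i j. if i = j then 1 else 0) x x"
      by (simp only: c1 mult_1 sform_id ip_self)
  qed
  moreover have "G a b \<in> carrier_mat d d" for a b by (simp add: G_def)
  ultimately have "robustness_feasible d nE E nF F (1 / 2 * (1 + 1 / s)) G"
    unfolding robustness_feasible_iff[OF mE mF] by blast
  then show ?thesis unfolding s_def by blast
qed

section \<open>Existence of the maximum\<close>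

text \<open>Bolzano-Weierstrass one coordinate at a time: a monotone subsequence for the new
  coordinate keeps the convergence of the earlier ones.\<close>

lemma bounded_family_convergent_subseq:
  fixes f :: "nat \<Rightarrow> 'i \<Rightarrow> real"
  assumes "finite I" and "\<And>i n. i \<in> I \<Longrightarrow> \<bar>f n i\<bar> \<le> B"
  shows "\<exists>r :: nat \<Rightarrow> nat. strict_mono r \<and> (\<forall>i\<in>I. convergent (\<lambda>n. f (r n) i))"
  using assms
proof (induction I rule: finite_induct)
  case empty
  then show ?case using strict_mono_id by (auto simp: id_def)
next
  case (insert i I)
  then obtain r :: "nat \<Rightarrow> nat" where r: "strict_mono r" "\<forall>i\<in>I. convergent (\<lambda>n. f (r n) i)" by auto
  obtain q :: "nat \<Rightarrow> nat" where q: "strict_mono q" "monoseq (\<lambda>n. f (r (q n)) i)"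
    using seq_monosub[of "\<lambda>n. f (r n) i"] by auto
  have "Bseq (\<lambda>n. f (r (q n)) i)"
    using insert.prems by (intro BseqI'[of _ B]) auto
  then have "convergent (\<lambda>n. f (r (q n)) i)" using q(2) by (rule Bseq_monoseq_convergent)
  moreover have "convergent (\<lambda>n. f (r (q n)) k)" if "k \<in> I" for k
    using convergent_subseq_convergent[OF r(2)[rule_format, OF that] q(1)] by (simp add: comp_def)
  ultimately show ?case
    using strict_mono_o[OF r(1) q(1)] by (intro exI[of _ "r \<circ> q"]) (auto simp: comp_def)
qed

lemma pos_limit:
  assumes "\<And>n. pos d (A n)" and "\<And>i j. i < d \<Longrightarrow> j < d \<Longrightarrow> (\<lambda>n. A n i j) \<longlonglongrightarrow> L i j"
  shows "pos d L"
  unfolding pos_def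
proof
  fix x
  have lim: "(\<lambda>n. sform d (A n) x x) \<longlonglongrightarrow> sform d L x x"
    unfolding sform_entries by (intro tendsto_sum tendsto_mult tendsto_const assms(2)) auto
  have "0 \<le> Re (sform d L x x)"
    by (rule LIMSEQ_le_const[OF tendsto_Re[OF lim]]) (use posD(1)[OF assms(1)] in auto)
  moreover have "(\<lambda>n. Im (sform d (A n) x x)) \<longlonglongrightarrow> Im (sform d L x x)"
    by (rule tendsto_Im[OF lim])
  then have "Im (sform d L x x) = 0"
    using posD(2)[OF assms(1)] by (simp add: LIMSEQ_const_iff)
  ultimately show "0 \<le> sform d L x x" by (simp add: less_eq_complex_def)
qed

text \<open>Summed over the outcomes of E, the constraints say that \<open>1 - \<eta>\<close> times
  the identity is positive; the corner entry already shows this.\<close>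

lemma feasible_le_1:
  assumes d: "1 \<le> d" and mE: "measurement d nE E" and mF: "measurement d nF F"
    and feas: "robustness_feasible d nE E nF F \<eta> G"
  shows "\<eta> \<le> 1"
proof -
  note fe = feas[unfolded robustness_feasible_iff[OF mE mF]]
  have "0 \<le> Re ((\<Sum>b\<in>{1..nF}. G a b $$ (0, 0)) - of_real \<eta> * E a $$ (0, 0))" if "a \<in> {1..nE}" for a
    using posD(1)[OF fe[THEN conjunct2, THEN conjunct1, THEN bspec, OF that], of "delta 0"] d
    by (simp add: sform_delta)
  then have "0 \<le> (\<Sum>a\<in>{1..nE}. Re ((\<Sum>b\<in>{1..nF}. G a b $$ (0, 0)) - of_real \<eta> * E a $$ (0, 0)))"
    by (rule sum_nonneg)
  also have "\<dots> = Re ((\<Sum>a\<in>{1..nE}. \<Sum>b\<in>{1..nF}. G a b $$ (0, 0)) - of_real \<eta> * (\<Sum>a\<in>{1..nE}. E a $$ (0, 0)))"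
    unfolding Re_sum[symmetric] sum_subtractf sum_distrib_left ..
  also have "(\<Sum>a\<in>{1..nE}. \<Sum>b\<in>{1..nF}. G a b $$ (0, 0)) = 1"
    using fe[THEN conjunct2, THEN conjunct2, THEN conjunct2, rule_format, of 0 0] d by simp
  also have "(\<Sum>a\<in>{1..nE}. E a $$ (0, 0)) = 1"
    using measurementD(4)[OF mE, of 0 0] d by simp
  finally show ?thesis by simp
qed

text \<open>Diagonal entries are nonnegative and sum to 1 over all pairs of outcomes; Cauchy-Schwarz
  carries the bound to the other entries.\<close>

lemma feasible_entry_le_1:
  assumes mE: "measurement d nE E" and mF: "measurement d nF F"
    and feas: "robustness_feasible d nE E nF F \<eta> G"
    and ab: "a \<in> {1..nE}" "b \<in> {1..nF}" and ij: "i < d" "j < d"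
  shows "cmod (G a b $$ (i, j)) \<le> 1"
proof -
  note fe = feas[unfolded robustness_feasible_iff[OF mE mF]]
  have pos: "pos d (entry (G a b))" if "a \<in> {1..nE}" "b \<in> {1..nF}" for a b
    using fe[THEN conjunct1, THEN bspec, THEN bspec, OF that] by (rule conjunct2)
  have nonneg: "0 \<le> Re (G a b $$ (i, i))" if "a \<in> {1..nE}" "b \<in> {1..nF}" "i < d" for a b i
    using posD(1)[OF pos[OF that(1,2)], of "delta i"] that(3) by (simp add: sform_delta)
  have le1: "Re (G a b $$ (i, i)) \<le> 1" if i: "i < d" for i
  proof -
    have "Re (G a b $$ (i, i)) \<le> (\<Sum>b\<in>{1..nF}. Re (G a b $$ (i, i)))"
      by (rule member_le_sum[OF ab(2)]) (use ab(1) i nonneg in auto)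
    also have "\<dots> \<le> (\<Sum>a\<in>{1..nE}. \<Sum>b\<in>{1..nF}. Re (G a b $$ (i, i)))"
      by (rule member_le_sum[OF ab(1)]) (use i nonneg in \<open>auto intro!: sum_nonneg\<close>)
    also have "\<dots> = Re (\<Sum>a\<in>{1..nE}. \<Sum>b\<in>{1..nF}. G a b $$ (i, i))"
      unfolding Re_sum ..
    also have "\<dots> = 1"
      using fe[THEN conjunct2, THEN conjunct2, THEN conjunct2, rule_format, OF i i] by simp
    finally show ?thesis .
  qed
  have "(cmod (G a b $$ (i, j)))\<^sup>2 \<le> Re (G a b $$ (j, j)) * Re (G a b $$ (i, i))"
    using pos_cauchy_schwarz[OF pos[OF ab], of "delta j" "delta i"] ij by (simp add: sform_delta)
  also have "\<dots> \<le> 1 * 1"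
    using le1 nonneg ab ij by (intro mult_mono) auto
  finally show ?thesis by (simp add: power_le_one_iff abs_square_le_1)
qed

text \<open>A limit of feasible families whose parameters approach the supremum is feasible at the
  supremum, since every constraint is a closed condition on finitely many entries.\<close>

lemma robustness_attained:
  assumes d: "1 \<le> d" and mE: "measurement d nE E" and mF: "measurement d nF F"
  obtains \<eta> G where "robustness_feasible d nE E nF F \<eta> G"
    and "\<And>\<eta>' G'. robustness_feasible d nE E nF F \<eta>' G' \<Longrightarrow> \<eta>' \<le> \<eta>"
proof -
  define S where "S = {\<eta>. \<exists>G. robustness_feasible d nE E nF F \<eta> G}"
  have bdd: "bdd_above S"
    using feasible_le_1[OF d mE mF] by (auto simp: S_def bdd_above_def)
  have ne: "S \<noteq> {}" using feasible_exists[OF d mE mF] by (auto simp: S_def)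
  have "\<exists>\<eta>\<in>S. Sup S - inverse (real (Suc n)) < \<eta>" for n
    using less_cSup_iff[OF ne bdd, of "Sup S - inverse (real (Suc n))"] by simp
  then have "\<forall>n. \<exists>\<eta> G. robustness_feasible d nE E nF F \<eta> G \<and> Sup S - inverse (real (Suc n)) < \<eta>"
    unfolding S_def by blast
  then obtain h G where hG: "\<And>n. robustness_feasible d nE E nF F (h n) (G n) \<and> Sup S - inverse (real (Suc n)) < h n"
    unfolding choice_iff by blast
  note feas = conjunct1[OF hG]
  have h_le: "h n \<le> Sup S" for n
    using feas by (intro cSup_upper bdd) (auto simp: S_def)
  have h: "h \<longlonglongrightarrow> Sup S"
  proof (rule tendsto_sandwich)
    show "(\<lambda>n. Sup S - inverse (real (Suc n))) \<longlonglongrightarrow> Sup S"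
      using tendsto_diff[OF tendsto_const LIMSEQ_inverse_real_of_nat, of "Sup S"] by simp
    show "\<forall>\<^sub>F n in sequentially. Sup S - inverse (real (Suc n)) \<le> h n"
      using hG by (intro always_eventually allI less_imp_le) blast
    show "\<forall>\<^sub>F n in sequentially. h n \<le> Sup S"
      using h_le by (intro always_eventually allI)
  qed (rule tendsto_const)
  \<comment> \<open>The Boolean component selects the real or the imaginary part, so that a finite
    family of real sequences describes all the matrices.\<close>
  define I where "I = {1..nE} \<times> {1..nF} \<times> {..<d} \<times> {..<d} \<times> (UNIV :: bool set)"
  define f where "f = (\<lambda>n (a, b, i, j, re). (if re then Re else Im) (G n a b $$ (i, j)))"
  have f_le: "\<bar>f n k\<bar> \<le> 1" if "k \<in> I" for n k
  proof -
    obtain a b i j re where k: "k = (a, b, i, j, re)" by (cases k)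
    have "cmod (G n a b $$ (i, j)) \<le> 1"
      by (rule feasible_entry_le_1[OF mE mF feas]) (use that in \<open>auto simp: I_def k\<close>)
    then show ?thesis
      using abs_Re_le_cmod[of "G n a b $$ (i, j)"] abs_Im_le_cmod[of "G n a b $$ (i, j)"]
      by (auto simp: f_def k)
  qed
  have "finite I" by (simp add: I_def)
  from bounded_family_convergent_subseq[of I f, OF this f_le]
  obtain r :: "nat \<Rightarrow> nat" where r: "strict_mono r" and conv: "\<forall>k\<in>I. convergent (\<lambda>n. f (r n) k)"
    by blast
  define L where "L = (\<lambda>a b. mat d d (\<lambda>(i, j). lim (\<lambda>n. G (r n) a b $$ (i, j))))"
  have L: "(\<lambda>n. G (r n) a b $$ (i, j)) \<longlonglongrightarrow> L a b $$ (i, j)"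
    if "a \<in> {1..nE}" "b \<in> {1..nF}" "i < d" "j < d" for a b i j
  proof -
    have "convergent (\<lambda>n. f (r n) (a, b, i, j, re))" for re
      using that by (intro conv[rule_format]) (simp add: I_def)
    from this[of True] this[of False]
    obtain x y where "(\<lambda>n. Re (G (r n) a b $$ (i, j))) \<longlonglongrightarrow> x" "(\<lambda>n. Im (G (r n) a b $$ (i, j))) \<longlonglongrightarrow> y"
      by (auto simp: f_def convergent_def)
    then have "(\<lambda>n. G (r n) a b $$ (i, j)) \<longlonglongrightarrow> Complex x y"
      by (simp add: tendsto_complex_iff)
    then have "convergent (\<lambda>n. G (r n) a b $$ (i, j))" by (auto simp: convergent_def)
    then show ?thesis using that by (simp add: L_def convergent_LIMSEQ_iff)
  qed
  have hr: "(\<lambda>n. complex_of_real (h (r n))) \<longlonglongrightarrow> of_real (Sup S)"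
    using tendsto_of_real[OF LIMSEQ_subseq_LIMSEQ[OF h r]] by (simp add: comp_def)
  note fe = feas[unfolded robustness_feasible_iff[OF mE mF]]
  have "pos d (entry (L a b))" if "a \<in> {1..nE}" "b \<in> {1..nF}" for a b
    by (rule pos_limit[of d "\<lambda>n. entry (G (r n) a b)"])
      (use fe[THEN conjunct1, THEN bspec, THEN bspec, THEN conjunct2] L that in auto)
  moreover have "pos d (\<lambda>i j. (\<Sum>b\<in>{1..nF}. L a b $$ (i, j)) - of_real (Sup S) * E a $$ (i, j))" if "a \<in> {1..nE}" for a
  proof (rule pos_limit[where A="\<lambda>n i j. (\<Sum>b\<in>{1..nF}. G (r n) a b $$ (i, j)) - of_real (h (r n)) * E a $$ (i, j)"])
    show "pos d (\<lambda>i j. (\<Sum>b\<in>{1..nF}. G (r n) a b $$ (i, j)) - of_real (h (r n)) * E a $$ (i, j))" for n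
      using fe[of "r n", THEN conjunct2, THEN conjunct1] that by (rule bspec)
    show "(\<lambda>n. (\<Sum>b\<in>{1..nF}. G (r n) a b $$ (i, j)) - of_real (h (r n)) * E a $$ (i, j))
        \<longlonglongrightarrow> (\<Sum>b\<in>{1..nF}. L a b $$ (i, j)) - of_real (Sup S) * E a $$ (i, j)" if "i < d" "j < d" for i j
      by (intro tendsto_diff tendsto_sum tendsto_mult tendsto_const hr L that \<open>a \<in> _\<close>)
  qed
  moreover have "pos d (\<lambda>i j. (\<Sum>a\<in>{1..nE}. L a b $$ (i, j)) - of_real (Sup S) * F b $$ (i, j))" if "b \<in> {1..nF}" for b
  proof (rule pos_limit[where A="\<lambda>n i j. (\<Sum>a\<in>{1..nE}. G (r n) a b $$ (i, j)) - of_real (h (r n)) * F b $$ (i, j)"])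
    show "pos d (\<lambda>i j. (\<Sum>a\<in>{1..nE}. G (r n) a b $$ (i, j)) - of_real (h (r n)) * F b $$ (i, j))" for n
      using fe[of "r n", THEN conjunct2, THEN conjunct2, THEN conjunct1] that by (rule bspec)
    show "(\<lambda>n. (\<Sum>a\<in>{1..nE}. G (r n) a b $$ (i, j)) - of_real (h (r n)) * F b $$ (i, j))
        \<longlonglongrightarrow> (\<Sum>a\<in>{1..nE}. L a b $$ (i, j)) - of_real (Sup S) * F b $$ (i, j)" if "i < d" "j < d" for i j
      by (intro tendsto_diff tendsto_sum tendsto_mult tendsto_const hr L that \<open>b \<in> _\<close>)
  qed
  moreover have "(\<Sum>a\<in>{1..nE}. \<Sum>b\<in>{1..nF}. L a b $$ (i, j)) = (if i = j then 1 else 0)" if "i < d" "j < d" for i j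
  proof -
    have "(\<lambda>n. \<Sum>a\<in>{1..nE}. \<Sum>b\<in>{1..nF}. G (r n) a b $$ (i, j)) \<longlonglongrightarrow> (\<Sum>a\<in>{1..nE}. \<Sum>b\<in>{1..nF}. L a b $$ (i, j))"
      using that by (intro tendsto_sum L)
    moreover have "(\<lambda>n. \<Sum>a\<in>{1..nE}. \<Sum>b\<in>{1..nF}. G (r n) a b $$ (i, j)) = (\<lambda>n. if i = j then 1 else 0)"
      using fe[THEN conjunct2, THEN conjunct2, THEN conjunct2, rule_format, OF that] by (rule ext)
    ultimately show ?thesis by (simp only: LIMSEQ_const_iff)
  qed
  moreover have "L a b \<in> carrier_mat d d" for a b by (simp add: L_def)
  ultimately have "robustness_feasible d nE E nF F (Sup S) L"
    unfolding robustness_feasible_iff[OF mE mF] by blast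
  then show thesis
    by (rule that) (use bdd in \<open>auto simp: S_def intro!: cSup_upper\<close>)
qed

theorem mainTheorem5:
  fixes p :: ereal and d nE nF :: nat and E F :: "nat \<Rightarrow> complex mat"
  assumes "1 \<le> d"
    and "1 \<le> p"
    and "measurement d nE E"
    and "measurement d nF F"
    and "Upsilon p nE E nF F = two_root p * real d * sqrt (real d - 1)"
  shows "generalized_robustness d nE E nF F = 1 / 2 * (1 + 1 / sqrt (real d)) \<and>
    (\<forall>nE' nF' E' F'. measurement d nE' E' \<longrightarrow> measurement d nF' F' \<longrightarrow>
       generalized_robustness d nE E nF F \<le> generalized_robustness d nE' E' nF' F')"
proof -
  have eq: "generalized_robustness d nE E nF F = 1 / 2 * (1 + 1 / sqrt (real d))"
    unfolding generalized_robustness_def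
    by (rule Greatest_equality) (use feasible_exists[OF assms(1,3,4)] Upsilon_max_feasible_le[OF assms] in blast)+
  \<comment> \<open>For an arbitrary pair the explicit family is feasible but perhaps not optimal,
    so the maximum is obtained from compactness before being compared with it.\<close>
  have "1 / 2 * (1 + 1 / sqrt (real d)) \<le> generalized_robustness d nE' E' nF' F'"
    if E': "measurement d nE' E'" and F': "measurement d nF' F'" for nE' nF' E' F'
  proof -
    obtain \<eta> G where \<eta>: "robustness_feasible d nE' E' nF' F' \<eta> G"
      and max: "\<And>\<eta>' G'. robustness_feasible d nE' E' nF' F' \<eta>' G' \<Longrightarrow> \<eta>' \<le> \<eta>"
      by (rule robustness_attained[OF assms(1) E' F']) blast
    have "generalized_robustness d nE' E' nF' F' = \<eta>"
      unfolding generalized_robustness_def by (rule Greatest_equality) (use \<eta> max in blast)+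
    then show ?thesis using feasible_exists[OF assms(1) E' F'] max by blast
  qed
  then show ?thesis unfolding eq by blast
qed

end
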